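(* Let $\delta\ge1$. Every residual $\pi\in\mathcal{R}_{\delta,n}$ has a set $T$ of at most $\delta+7$ entries with $e(\pi\setminus T)\le\delta-1$. Consequently $$|\mathrm{sk}(\pi)|\le 8\delta+25,$$ so $\Sigma_\delta$ consists of reduced permutations of length at most $8\delta+25$ and is finite.
   Context: Permutations are written in one-line notation $\pi=\pi_1\cdots\pi_n$, and $\operatorname{inv}(\pi)$ is the number of pairs $i<j$ with $\pi_i>\pi_j$. A permutation avoids $1324$ if there are no indices $i_1<i_2<i_3<i_4$ with $\pi_{i_1}<\pi_{i_3}<\pi_{i_2}<\pi_{i_4}$. $\mathrm{Av}_n^k(1324)$ is the set of $1324$-avoiding permutations of length $n$ with exactly $k$ inversions. A permutation of length $n$ is decomposable if for some $1\le j<n$ its first $j$ entries are exactly $\{1,\dots,j\}$; otherwise it is indecomposable. $\pi\setminus x$ is obtained by deleting the entry $x$ and standardizing. An indecomposable $\pi$ of length $n$ is almost decomposable if at least one of $\pi\setminus 1$, $\pi\setminus n$, $\pi\setminus\pi_1$, $\pi\setminus\pi_n$ (deleting the smallest, largest, first, last entry) is decomposable. The set of residuals at defect $\delta$ is $$\mathcal{R}_{\delta,n}=\{\pi\in\mathrm{Av}_n^{2n-7+\delta}(1324):\ \pi\text{ is indecomposable and not almost decomposable}\}.$$ For a set $T$ of entries (or positions), $e(\pi\setminus T)$ is the number of inversions of $\pi$ with neither end in $T$. A permutation $\sigma$ is reduced if $\sigma_{i+1}\ne\sigma_i+1$ for all $i$. Every permutation $\pi$ is uniquely the inflation $\sigma[b]$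 of a reduced $\sigma$ by increasing runs of sizes $b_i\ge1$ (consecutive positions and values; contract the maximal runs of consecutive positions carrying consecutive increasing values); $\mathrm{sk}(\pi)=\sigma$ is the skeleton. $\Sigma_\delta$ is the set of skeletons of all members of $\bigcup_n\mathcal{R}_{\delta,n}$. *)

theory Defs
  imports Main
begin

text \<open>A permutation of length \<open>n\<close> is the list of its entries, a rearrangement of
  \<open>1, \<dots>, n\<close>.  Entries are numbered from 1, list positions from 0.\<close>

definition permutation :: "nat list \<Rightarrow> bool" where
  "permutation p \<longleftrightarrow> distinct p \<and> set p = {1..length p}"

definition inversions :: "nat list \<Rightarrow> (nat \<times> nat) set" where
  "inversions p = {(i, j). i < j \<and> j < length p \<and> p ! i > p ! j}"

definition inv_count :: "nat list \<Rightarrow> nat" where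
  "inv_count p = card (inversions p)"

text \<open>The number \<open>e(p \<setminus> T)\<close> for a set \<open>T\<close> of entries (values).\<close>

definition inv_count_outside :: "nat list \<Rightarrow> nat set \<Rightarrow> nat" where
  "inv_count_outside p T = card {(i, j) \<in> inversions p. p ! i \<notin> T \<and> p ! j \<notin> T}"

definition avoids_1324 :: "nat list \<Rightarrow> bool" where
  "avoids_1324 p \<longleftrightarrow>
     \<not> (\<exists>i1 i2 i3 i4. i1 < i2 \<and> i2 < i3 \<and> i3 < i4 \<and> i4 < length p \<and>
          p ! i1 < p ! i3 \<and> p ! i3 < p ! i2 \<and> p ! i2 < p ! i4)"

text \<open>The number of inversions is compared in the integers, so that the set is empty for
  negative \<open>k\<close>.\<close>

definition Av1324 :: "nat \<Rightarrow> int \<Rightarrow> nat list set" where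
  "Av1324 n k = {p. permutation p \<and> length p = n \<and> avoids_1324 p \<and> int (inv_count p) = k}"

definition decomposable :: "nat list \<Rightarrow> bool" where
  "decomposable p \<longleftrightarrow> (\<exists>j. 1 \<le> j \<and> j < length p \<and> set (take j p) = {1..j})"

definition standardize :: "nat list \<Rightarrow> nat list" where
  "standardize xs = map (\<lambda>x. card {y \<in> set xs. y \<le> x}) xs"

definition delete_entry :: "nat list \<Rightarrow> nat \<Rightarrow> nat list" where
  "delete_entry p x = standardize (removeAll x p)"

definition almost_decomposable :: "nat list \<Rightarrow> bool" where
  "almost_decomposable p \<longleftrightarrow> \<not> decomposable p \<and>
     (decomposable (delete_entry p 1) \<or> decomposable (delete_entry p (length p)) \<or>
      decomposable (delete_entry p (hd p)) \<or> decomposable (delete_entry p (last p)))"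

definition residuals :: "nat \<Rightarrow> nat \<Rightarrow> nat list set" where
  "residuals \<delta> n = {p \<in> Av1324 n (2 * int n - 7 + int \<delta>).
     \<not> decomposable p \<and> \<not> almost_decomposable p}"

definition reduced :: "nat list \<Rightarrow> bool" where
  "reduced s \<longleftrightarrow> (\<forall>i. Suc i < length s \<longrightarrow> s ! Suc i \<noteq> s ! i + 1)"

text \<open>In \<open>inflate s b\<close> the \<open>i\<close>-th entry of \<open>s\<close> becomes a run of \<open>b ! i\<close> consecutive values;
  the values below that run are those of the runs replacing smaller entries of \<open>s\<close>, and
  \<open>offset s b i\<close> is their number.\<close>

definition offset :: "nat list \<Rightarrow> nat list \<Rightarrow> nat \<Rightarrow> nat" where
  "offset s b i = (\<Sum>j | j < length s \<and> s ! j < s ! i. b ! j)"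

definition inflate :: "nat list \<Rightarrow> nat list \<Rightarrow> nat list" where
  "inflate s b =
     concat (map (\<lambda>i. [offset s b i + 1 ..< offset s b i + b ! i + 1]) [0..<length s])"

definition reduced_inflation :: "nat list \<Rightarrow> nat list \<Rightarrow> nat list \<Rightarrow> bool" where
  "reduced_inflation p s b \<longleftrightarrow> permutation s \<and> reduced s \<and>
     length b = length s \<and> (\<forall>k \<in> set b. 1 \<le> k) \<and> p = inflate s b"

text \<open>For a permutation \<open>p\<close> the pair \<open>(s, b)\<close> exists and is unique; see
  \<open>ex1_reduced_inflation\<close> below.\<close>

definition skeleton :: "nat list \<Rightarrow> nat list" where
  "skeleton p = (THE s. \<exists>b. reduced_inflation p s b)"

definition skeletons :: "nat \<Rightarrow> nat list set" where
  "skeletons \<delta> = skeleton ` (\<Union>n. residuals \<delta> n)"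


subsection \<open>Existence and uniqueness of the skeleton\<close>

text \<open>A pair \<open>(o, k)\<close> stands for the run \<open>o + 1, \<dots>, o + k\<close>.\<close>

definition runs_concat :: "(nat \<times> nat) list \<Rightarrow> nat list" where
  "runs_concat ps = concat (map (\<lambda>(a, k). [a + 1 ..< a + k + 1]) ps)"

definition maximal_runs :: "(nat \<times> nat) list \<Rightarrow> bool" where
  "maximal_runs ps \<longleftrightarrow> (\<forall>(a, k) \<in> set ps. 1 \<le> k) \<and>
     successively (\<lambda>p q. fst q \<noteq> fst p + snd p) ps"

lemma runs_concat_simps [simp]:
  "runs_concat [] = []"
  "runs_concat ((a, k) # ps) = [a + 1 ..< a + k + 1] @ runs_concat ps"
  by (simp_all add: runs_concat_def)

lemma upt_head: "1 \<le> k \<Longrightarrow> [a + 1 ..< a + k + 1] = (a + 1) # [a + 2 ..< a + k + 1]"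
  by (simp add: upt_conv_Cons)

lemma maximal_runs_exist:
  "0 \<notin> set xs \<Longrightarrow> \<exists>ps. maximal_runs ps \<and> runs_concat ps = xs"
proof (induction xs)
  case Nil
  then show ?case by (intro exI[of _ "[]"]) (simp add: maximal_runs_def)
next
  case (Cons x xs)
  then obtain ps where ps: "maximal_runs ps" "runs_concat ps = xs" by auto
  from Cons.prems obtain a where x: "x = Suc a" by (cases x) auto
  show ?case
  proof (cases ps)
    case Nil
    then show ?thesis using ps x
      by (intro exI[of _ "[(a, 1)]"]) (auto simp: maximal_runs_def)
  next
    case (Cons q qs)
    obtain c k where q: "q = (c, k)" by (cases q)
    have k: "1 \<le> k" using ps Cons q by (auto simp: maximal_runs_def)
    show ?thesis
    proof (cases "c = Suc a")
      case True
      have "maximal_runs ((a, Suc k) # qs)"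
        using ps Cons q True by (cases qs) (auto simp: maximal_runs_def)
      moreover have "runs_concat ((a, Suc k) # qs) = x # xs"
        using ps Cons q True x k by (auto simp: upt_conv_Cons simp del: upt_Suc)
      ultimately show ?thesis by blast
    next
      case False
      have "maximal_runs ((a, 1) # ps)"
        using ps Cons q False by (auto simp: maximal_runs_def)
      moreover have "runs_concat ((a, 1) # ps) = x # xs" using ps x by simp
      ultimately show ?thesis by blast
    qed
  qed
qed

lemma runs_concat_length_le:
  assumes m: "maximal_runs ((a, k) # ps)" "maximal_runs ((a, l) # qs)"
    and eq: "runs_concat ((a, k) # ps) = runs_concat ((a, l) # qs)"
  shows "l \<le> k"
proof (rule ccontr)
  assume "\<not> l \<le> k"
  then have "[a + 1 ..< a + l + 1] = [a + 1 ..< a + k + 1] @ [a + k + 1 ..< a + l + 1]"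
    using upt_add_eq_append[of "a + 1" "a + k + 1" "l - k"] by (simp del: upt_Suc)
  with eq have "runs_concat ps = [a + k + 1 ..< a + l + 1] @ runs_concat qs" by simp
  then have r: "runs_concat ps = (a + k + 1) # [a + k + 2 ..< a + l + 1] @ runs_concat qs"
    using \<open>\<not> l \<le> k\<close> by (simp add: upt_conv_Cons del: upt_Suc)
  then obtain c j ps' where ps: "ps = (c, j) # ps'" by (cases ps) auto
  with m(1) have j: "1 \<le> j" "c \<noteq> a + k" by (auto simp: maximal_runs_def)
  have "hd (runs_concat ps) = c + 1"
    using ps upt_head[OF j(1), of c] by simp
  with r j show False by simp
qed

lemma runs_concat_eq_Nil_iff: "maximal_runs ps \<Longrightarrow> runs_concat ps = [] \<longleftrightarrow> ps = []"
  by (cases ps) (auto simp: maximal_runs_def)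

lemma maximal_runs_unique:
  "maximal_runs ps \<Longrightarrow> maximal_runs qs \<Longrightarrow> runs_concat ps = runs_concat qs \<Longrightarrow> ps = qs"
proof (induction ps arbitrary: qs)
  case Nil
  then show ?case by (metis runs_concat_eq_Nil_iff)
next
  case (Cons p ps)
  obtain a k where p: "p = (a, k)" by (cases p)
  have k: "1 \<le> k" using Cons.prems p by (auto simp: maximal_runs_def)
  have "qs \<noteq> []" using Cons.prems runs_concat_eq_Nil_iff by fastforce
  then obtain c l qs' where qs: "qs = (c, l) # qs'" by (cases qs) auto
  have l: "1 \<le> l" using Cons.prems qs by (auto simp: maximal_runs_def)
  have ac: "a = c"
    using Cons.prems(3) p qs upt_head[OF k, of a] upt_head[OF l, of c] by simp
  have "k = l"
    using runs_concat_length_le[of a k ps l qs'] runs_concat_length_le[of a l qs' k ps]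
      Cons.prems unfolding p qs ac by (metis order_antisym)
  moreover have "maximal_runs ps" "maximal_runs qs'"
    using Cons.prems p qs by (auto simp: maximal_runs_def successively_Cons)
  moreover have "runs_concat ps = runs_concat qs'"
    using Cons.prems(3) ac \<open>k = l\<close> unfolding p qs runs_concat_simps by (metis same_append_eq)
  ultimately show ?case using Cons.IH[of qs'] p qs ac by simp
qed

lemma card_le_less:
  fixes x y :: nat
  assumes "x < y" "y \<in> set xs"
  shows "card {z \<in> set xs. z \<le> x} < card {z \<in> set xs. z \<le> y}"
proof (rule psubset_card_mono)
  have "y \<in> {z \<in> set xs. z \<le> y}" "y \<notin> {z \<in> set xs. z \<le> x}" using assms by auto
  moreover have "{z \<in> set xs. z \<le> x} \<subseteq> {z \<in> set xs. z \<le> y}" using assms by auto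
  ultimately show "{z \<in> set xs. z \<le> x} \<subset> {z \<in> set xs. z \<le> y}" by blast
qed simp

lemma permutation_standardize:
  assumes "distinct xs"
  shows "permutation (standardize xs)"
proof -
  let ?f = "\<lambda>x. card {y \<in> set xs. y \<le> x}"
  note less = card_le_less[of _ _ xs]
  have inj: "inj_on ?f (set xs)"
  proof (rule linorder_inj_onI)
    fix x y assume "x < y" "x \<in> set xs" "y \<in> set xs"
    then show "?f x \<noteq> ?f y" using less[of x y] by simp
  qed auto
  have d: "distinct (standardize xs)"
    using assms inj by (simp add: standardize_def distinct_map)
  have "?f x \<in> {1..length xs}" if "x \<in> set xs" for x
  proof -
    have "?f x \<le> card (set xs)" by (intro card_mono) auto
    moreover have "card {x} \<le> ?f x" using that by (intro card_mono) auto
    moreover note card_length[of xs]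
    ultimately show ?thesis by (simp del: One_nat_def)
  qed
  then have "set (standardize xs) \<subseteq> {1..length (standardize xs)}"
    by (auto simp: standardize_def)
  then have "set (standardize xs) = {1..length (standardize xs)}"
    using d by (intro card_subset_eq) (auto simp: distinct_card)
  with d show ?thesis by (simp add: permutation_def)
qed

lemma standardize_less_iff:
  assumes "i < length xs" "j < length xs"
  shows "standardize xs ! i < standardize xs ! j \<longleftrightarrow> xs ! i < xs ! j"
proof -
  have nth: "standardize xs ! l = card {z \<in> set xs. z \<le> xs ! l}" if "l < length xs" for l
    using that by (simp add: standardize_def)
  have "xs ! i \<in> set xs" "xs ! j \<in> set xs" using assms by auto
  then show ?thesis
    using card_le_less[of "xs ! i" "xs ! j" xs] card_le_less[of "xs ! j" "xs ! i" xs]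
      nth[OF assms(1)] nth[OF assms(2)]
    by (cases "xs ! i" "xs ! j" rule: linorder_cases) simp_all
qed

lemma nth_eq_card:
  assumes "permutation s" "i < length s"
  shows "s ! i = card {j. j < length s \<and> s ! j \<le> s ! i}"
proof -
  have "bij_betw ((!) s) {j. j < length s \<and> s ! j \<le> s ! i} {1..s ! i}"
    unfolding bij_betw_def
  proof
    show "inj_on ((!) s) {j. j < length s \<and> s ! j \<le> s ! i}"
      using assms by (auto simp: inj_on_def permutation_def nth_eq_iff_index_eq)
    have "s ! i \<in> {1..length s}" using assms nth_mem unfolding permutation_def by metis
    moreover have "x \<in> (!) s ` {j. j < length s \<and> s ! j \<le> s ! i}" if "x \<in> {1..s ! i}" for x
    proof -
      have "x \<in> set s" using that calculation assms by (auto simp: permutation_def)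
      then show ?thesis using that by (auto simp: in_set_conv_nth)
    qed
    moreover have "1 \<le> s ! j" if "j < length s" for j
      using assms nth_mem[OF that] unfolding permutation_def by (metis atLeastAtMost_iff)
    ultimately show "(!) s ` {j. j < length s \<and> s ! j \<le> s ! i} = {1..s ! i}"
      by auto
  qed
  from bij_betw_same_card[OF this] show ?thesis by simp
qed

definition inflation_runs :: "nat list \<Rightarrow> nat list \<Rightarrow> (nat \<times> nat) list" where
  "inflation_runs s b = map (\<lambda>i. (offset s b i, b ! i)) [0..<length s]"

lemma inflate_eq_runs_concat: "inflate s b = runs_concat (inflation_runs s b)"
  by (simp add: inflate_def runs_concat_def inflation_runs_def comp_def)

lemma offset_less:
  assumes "i < length s" "s ! i < s ! j"
  shows "offset s b i + b ! i \<le> offset s b j"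
proof -
  have "offset s b i + b ! i = (\<Sum>l\<in>insert i {l. l < length s \<and> s ! l < s ! i}. b ! l)"
    by (simp add: offset_def)
  also have "\<dots> \<le> offset s b j"
    unfolding offset_def using assms by (intro sum_mono2) auto
  finally show ?thesis .
qed

lemma offset_le_iff:
  assumes "length b = length s" "\<forall>k \<in> set b. 1 \<le> k" "i < length s" "j < length s"
  shows "offset s b j \<le> offset s b i \<longleftrightarrow> s ! j \<le> s ! i"
proof
  assume le: "offset s b j \<le> offset s b i"
  have "1 \<le> b ! i" using assms by auto
  with le offset_less[of i s j b] assms show "s ! j \<le> s ! i" by force
next
  assume "s ! j \<le> s ! i"
  then show "offset s b j \<le> offset s b i"
    unfolding offset_def by (intro sum_mono2) auto
qed

lemma maximal_inflation_runs:
  assumes "reduced_inflation p s b"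
  shows "maximal_runs (inflation_runs s b)"
proof -
  from assms have s: "permutation s" "reduced s" "length b = length s" "\<forall>k \<in> set b. 1 \<le> k"
    by (auto simp: reduced_inflation_def)
  have pos: "1 \<le> b ! i" if "i < length s" for i using s that by auto
  have "offset s b (Suc i) \<noteq> offset s b i + b ! i" if i: "Suc i < length s" for i
  proof
    assume eq: "offset s b (Suc i) = offset s b i + b ! i"
    with pos[of i] i have "\<not> offset s b (Suc i) \<le> offset s b i" by simp
    then have lt: "s ! i < s ! Suc i"
      using offset_le_iff[OF s(3,4), of i "Suc i"] i by simp
    with s(2) i have lt2: "s ! i + 1 < s ! Suc i" by (fastforce simp: reduced_def)
    have "s ! Suc i \<in> set s" using i by simp
    with s(1) lt2 have "s ! i + 1 \<in> set s" by (auto simp: permutation_def)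
    then obtain j where j: "j < length s" "s ! j = s ! i + 1" by (auto simp: in_set_conv_nth)
    have "offset s b i + b ! i \<le> offset s b j" using i j by (intro offset_less) auto
    moreover have "offset s b j + b ! j \<le> offset s b (Suc i)"
      using i j lt2 by (intro offset_less) auto
    ultimately show False using eq pos[OF j(1)] by simp
  qed
  then show ?thesis
    using pos by (auto simp: maximal_runs_def inflation_runs_def successively_conv_nth)
qed

lemma reduced_inflation_unique:
  assumes "reduced_inflation p s b" "reduced_inflation p s' b'"
  shows "s = s' \<and> b = b'"
proof -
  have "runs_concat (inflation_runs s b) = runs_concat (inflation_runs s' b')"
  proof -
    have "p = runs_concat (inflation_runs s b)" "p = runs_concat (inflation_runs s' b')"
      using assms unfolding reduced_inflation_def inflate_eq_runs_concat by blast+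
    then show ?thesis by (rule subst)
  qed
  then have eq: "inflation_runs s b = inflation_runs s' b'"
    by (rule maximal_runs_unique[OF assms[THEN maximal_inflation_runs]])
  from assms have s: "permutation s" "length b = length s" "\<forall>k \<in> set b. 1 \<le> k"
    and s': "permutation s'" "length b' = length s'" "\<forall>k \<in> set b'. 1 \<le> k"
    unfolding reduced_inflation_def by blast+
  have len: "length s = length s'"
    using arg_cong[OF eq, of length] by (simp add: inflation_runs_def)
  have nth: "offset s b i = offset s' b' i" "b ! i = b' ! i" if "i < length s" for i
  proof -
    have "inflation_runs s b ! i = (offset s b i, b ! i)"
      using that by (simp add: inflation_runs_def)
    moreover have "inflation_runs s' b' ! i = (offset s' b' i, b' ! i)"
      using that len by (simp add: inflation_runs_def)
    ultimately show "offset s b i = offset s' b' i" "b ! i = b' ! i" using eq by simp_all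
  qed
  have "b = b'" 
  proof (rule nth_equalityI)
    show "length b = length b'" using s(2) s'(2) len by simp
    show "b ! i = b' ! i" if "i < length b" for i using nth(2)[of i] that s(2) by simp
  qed

  moreover have "s = s'"
  proof (rule nth_equalityI[OF len])
    fix i assume i: "i < length s"
    with len have i': "i < length s'" by simp
    have "s ! i = card {j. j < length s \<and> s ! j \<le> s ! i}"
      by (rule nth_eq_card[OF s(1) i])
    also have "\<dots> = card {j. j < length s \<and> offset s b j \<le> offset s b i}"
      by (intro arg_cong[of _ _ card] Collect_cong conj_cong refl)
        (simp add: offset_le_iff[OF s(2,3) i])
    also have "\<dots> = card {j. j < length s' \<and> offset s' b' j \<le> offset s' b' i}"
    proof (intro arg_cong[of _ _ card] Collect_cong)
      show "j < length s \<and> offset s b j \<le> offset s b i \<longleftrightarrow>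
          j < length s' \<and> offset s' b' j \<le> offset s' b' i" for j
        using nth(1)[OF i] nth(1)[of j] len by (cases "j < length s") simp_all
    qed
    also have "\<dots> = card {j. j < length s' \<and> s' ! j \<le> s' ! i}"
      by (intro arg_cong[of _ _ card] Collect_cong conj_cong refl)
        (simp add: offset_le_iff[OF s'(2,3) i'])
    also have "\<dots> = s' ! i"
      by (rule nth_eq_card[OF s'(1) i', symmetric])
    finally show "s ! i = s' ! i" .
  qed
  ultimately show ?thesis by simp
qed

lemma reduced_inflation_exists:
  assumes p: "permutation p"
  shows "\<exists>s b. reduced_inflation p s b"
proof -
  have "0 \<notin> set p" using p by (simp add: permutation_def)
  then obtain ps where ps: "maximal_runs ps" "runs_concat ps = p"
    using maximal_runs_exist by blast
  define n where "n = length ps"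
  define a k where "a i = fst (ps ! i)" and "k i = snd (ps ! i)" for i
  define B where "B i = {a i + 1 ..< a i + k i + 1}" for i
  have kpos: "1 \<le> k i" if "i < n" for i
    using ps(1) nth_mem[of i ps] that
    by (cases "ps ! i") (auto simp: maximal_runs_def k_def n_def simp del: nth_mem)
  have step: "a (Suc i) \<noteq> a i + k i" if "Suc i < n" for i
    using ps(1) that by (auto simp: maximal_runs_def successively_conv_nth a_def k_def n_def)
  have pc: "p = concat (map (\<lambda>i. [a i + 1 ..< a i + k i + 1]) [0..<n])"
  proof -
    have "map (\<lambda>i. (a i, k i)) [0..<n] = ps"
      by (rule nth_equalityI) (auto simp: a_def k_def n_def)
    then have "p = runs_concat (map (\<lambda>i. (a i, k i)) [0..<n])" using ps(2) by simp
    then show ?thesis by (simp add: runs_concat_def comp_def del: upt_Suc)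
  qed
  have cover: "(\<Union>i<n. B i) = {1..length p}"
  proof -
    have "set p = (\<Union>i<n. B i)" by (subst pc) (auto simp: B_def)
    with p show ?thesis by (simp add: permutation_def)
  qed
  have disj: "B i \<inter> B j = {}" if "i < n" "j < n" "i \<noteq> j" for i j
  proof -
    let ?f = "\<lambda>i. [a i + 1 ..< a i + k i + 1]"
    have "distinct (concat (map ?f [0..<n]))" using p pc by (simp add: permutation_def)
    then have d: "distinct (removeAll [] (map ?f [0..<n]))"
      "\<And>xs ys. xs \<in> set (map ?f [0..<n]) \<Longrightarrow> ys \<in> set (map ?f [0..<n]) \<Longrightarrow> xs \<noteq> ys
        \<Longrightarrow> set xs \<inter> set ys = {}"
      unfolding distinct_concat_iff by blast+
    have "[] \<notin> set (map ?f [0..<n])" 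
    proof
      assume "[] \<in> set (map ?f [0..<n])"
      then obtain i where "i < n" "?f i = []"
        by (metis (no_types, lifting) imageE atLeastLessThan_iff set_map set_upt)
      with kpos[of i] show False by (simp del: upt_Suc)
    qed
    with d(1) have "distinct (map ?f [0..<n])" by (metis removeAll_id)
    then have "?f i \<noteq> ?f j" using that nth_eq_iff_index_eq[of "map ?f [0..<n]" i j]
      by (simp del: upt_Suc)
    with d(2)[of "?f i" "?f j"] that show ?thesis by (simp add: B_def del: upt_Suc)
  qed
  have aB: "a i + 1 \<in> B i" if "i < n" for i using kpos[OF that] by (auto simp: B_def)
  have ainj: "a i \<noteq> a j" if "i < n" "j < n" "i \<noteq> j" for i j
    using disj[OF that] aB[OF that(1)] aB[OF that(2)] by auto
  define b where "b = map k [0..<n]"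
  define s where "s = standardize (map a [0..<n])"
  have len: "length s = n" "length b = n" by (simp_all add: s_def b_def standardize_def)
  have s: "permutation s" unfolding s_def
  proof (rule permutation_standardize)
    have "inj_on a {0..<n}" using ainj by (meson atLeastLessThan_iff inj_onI)
    then show "distinct (map a [0..<n])" by (simp add: distinct_map)
  qed
  have less: "s ! i < s ! j \<longleftrightarrow> a i < a j" if "i < n" "j < n" for i j
    using that standardize_less_iff[of i "map a [0..<n]" j] by (simp add: s_def)
  have off: "offset s b i = a i" if i: "i < n" for i
  proof -
    let ?J = "{j. j < n \<and> a j < a i}"
    have "{1..a i} = (\<Union>j\<in>?J. B j)"
    proof (intro equalityI subsetI)
      fix x assume x: "x \<in> {1..a i}"
      have "a i + 1 \<in> {1..length p}" using aB[OF i] cover i by blast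
      with x have "x \<in> {1..length p}" by auto
      then obtain j where "j < n" "x \<in> B j" using cover by blast
      with x show "x \<in> (\<Union>j\<in>?J. B j)" by (auto simp: B_def)
    next
      fix x assume "x \<in> (\<Union>j\<in>?J. B j)"
      then obtain j where j: "j < n" "a j < a i" "x \<in> B j" by auto
      have "x \<le> a i"
      proof (rule ccontr)
        assume "\<not> x \<le> a i"
        with j have "a i + 1 \<in> B j" by (auto simp: B_def)
        with disj[OF i j(1)] aB[OF i] j show False by auto
      qed
      with j show "x \<in> {1..a i}" by (auto simp: B_def)
    qed
    then have "a i = card (\<Union>j\<in>?J. B j)" by (metis card_atLeastAtMost diff_Suc_1 One_nat_def)
    also have "\<dots> = (\<Sum>j\<in>?J. card (B j))"
      using disj by (intro card_UN_disjoint) (auto simp: B_def)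
    also have "\<dots> = (\<Sum>j\<in>?J. b ! j)"
      by (intro sum.cong) (auto simp: B_def b_def)
    also have "?J = {j. j < length s \<and> s ! j < s ! i}" using less i len by auto
    finally show ?thesis by (simp add: offset_def)
  qed
  have "reduced s" unfolding reduced_def
  proof (intro allI impI notI)
    fix i assume i: "Suc i < length s" and eq: "s ! Suc i = s ! i + 1"
    have inj: "s ! j = s ! i \<longleftrightarrow> j = i" if "j < length s" for j
      using s i that by (auto simp: permutation_def nth_eq_iff_index_eq)
    have "{j. j < length s \<and> s ! j < s ! Suc i} = insert i {j. j < length s \<and> s ! j < s ! i}"
      using i eq inj by (auto simp: less_Suc_eq)
    then have "offset s b (Suc i) = offset s b i + b ! i" by (simp add: offset_def)
    with step[of i] off i len show False by (simp add: b_def)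
  qed
  moreover have "p = inflate s b"
  proof -
    have "offset s b i = a i \<and> b ! i = k i" if "i \<in> set [0..<n]" for i
      using off[of i] that by (simp add: b_def)
    then show ?thesis
      unfolding inflate_def len(1) by (subst pc, intro arg_cong[of _ _ concat] map_cong) auto
  qed
  moreover have "\<forall>k \<in> set b. 1 \<le> k" using kpos by (auto simp: b_def)
  ultimately have "reduced_inflation p s b" using s len by (simp add: reduced_inflation_def)
  then show ?thesis by blast
qed

lemma ex1_reduced_inflation:
  assumes "permutation p"
  shows "\<exists>!(s, b). reduced_inflation p s b"
proof -
  obtain s b where "reduced_inflation p s b" using reduced_inflation_exists[OF assms] by blast
  then show ?thesis using reduced_inflation_unique by (intro ex1I[of _ "(s, b)"]) auto
qed

lemma skeleton_eq: "reduced_inflation p s b \<Longrightarrow> skeleton p = s"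
  unfolding skeleton_def using reduced_inflation_unique by blast

end

theory Submission
  imports Defs
begin

text \<open>Draw a permutation as the set of points (position, value) and join two points by an edge
  if they form an inversion.  Let \<open>l\<close>, \<open>r\<close>, \<open>d\<close>, \<open>u\<close> be the leftmost, rightmost, lowest and
  highest point, so that the four deletions in the definition of almost decomposability are
  those of \<open>l\<close>, \<open>r\<close>, \<open>d\<close>, \<open>u\<close>.  A residual of length \<open>n\<close> at defect \<open>\<delta>\<close> has \<open>2n - 7 + \<delta>\<close>
  edges, so it suffices to find at most seven points that meet at least \<open>2n - 6\<close> edges; this is
  \<open>covering\<close>, which does not involve \<open>\<delta>\<close>.

  The set contains \<open>l\<close>, \<open>r\<close>, \<open>d\<close>, \<open>u\<close>, and the edges are counted by charging: every other
  point is assigned two edges of its own that lead into the set (\<open>charging\<close>).  If the four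
  points are distinct, the two edges \<open>ld\<close> and \<open>ur\<close> bring the total to
  \<open>2(n - 4) + 2 = 2n - 6\<close>.  A point left of \<open>d\<close> is joined to \<open>d\<close>, one right of \<open>u\<close> to \<open>u\<close>,
  one below \<open>l\<close> to \<open>l\<close> and one above \<open>r\<close> to \<open>r\<close>; trouble arises only for points
  horizontally between \<open>d\<close> and \<open>u\<close> if \<open>d\<close> precedes \<open>u\<close>, and for those vertically between \<open>l\<close>
  and \<open>r\<close> if \<open>l\<close> lies below \<open>r\<close>.  If such a point is joined to a single extreme point, it
  needs a further edge.  Since deleting that extreme point does not isolate it, it has another
  neighbour, and because 1324 is avoided, the neighbourhoods of the troublesome points of the
  same kind are nested.  Hence one neighbour, a hub, serves all of them (\<open>lower_middle_hub\<close>
  and its images under symmetries).  If \<open>d\<close> precedes \<open>u\<close> and \<open>l\<close> lies below \<open>r\<close>, there are four kinds of troublesome points, but indecomposability provides a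
  point in one of two corners that serves two kinds at once (\<open>corner_nonempty\<close>), so three
  further points are enough.  The cases \<open>l = u\<close> and \<open>r = d\<close> are similar.

  For the length of the skeleton, let \<open>T\<close> be such a set.  The skeleton has one entry for each
  position at which a maximal run ends.  At such a position \<open>i\<close>, other than the last, either one
  of the entries at \<open>i\<close> and \<open>i + 1\<close> lies in \<open>T\<close> or in an inversion outside \<open>T\<close>, or the
  entry at \<open>i\<close> increased by one belongs to \<open>T\<close>.  This gives at most
  \<open>1 + 3 |T| + 4 (\<delta> - 1)\<close> such positions.\<close>

section \<open>Edges and separations of a point configuration\<close>

text \<open>A configuration is a finite set \<open>S\<close> of points with coordinate functions \<open>X\<close> and \<open>Y\<close>.  The
  coordinates are integers so that it can be rotated by negating them.\<close>

text \<open>Two points cross if they form an inversion, in either order.\<close>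

definition crossing :: "('a \<Rightarrow> int) \<Rightarrow> ('a \<Rightarrow> int) \<Rightarrow> 'a \<Rightarrow> 'a \<Rightarrow> bool" where
  "crossing X Y p q \<longleftrightarrow> (X p < X q \<and> Y q < Y p) \<or> (X q < X p \<and> Y p < Y q)"

text \<open>Edges are unordered pairs, so that symmetries of the configuration preserve them.\<close>

definition edges :: "('a \<Rightarrow> int) \<Rightarrow> ('a \<Rightarrow> int) \<Rightarrow> 'a set \<Rightarrow> 'a set set" where
  "edges X Y S = {{p, q} | p q. p \<in> S \<and> q \<in> S \<and> crossing X Y p q}"

text \<open>The edges in \<open>E\<close> that have an end in \<open>T\<close>.\<close>

definition meeting :: "'a set set \<Rightarrow> 'a set \<Rightarrow> 'a set set" where
  "meeting E T = {e \<in> E. e \<inter> T \<noteq> {}}"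

text \<open>The set \<open>D\<close> witnesses that \<open>S\<close> is decomposable: it is nonempty and proper, and all its
  points are to the left of and below the remaining ones.\<close>

definition separates :: "('a \<Rightarrow> int) \<Rightarrow> ('a \<Rightarrow> int) \<Rightarrow> 'a set \<Rightarrow> 'a set \<Rightarrow> bool" where
  "separates X Y S D \<longleftrightarrow> D \<noteq> {} \<and> D \<subset> S \<and> (\<forall>p\<in>D. \<forall>q\<in>S - D. X p < X q \<and> Y p < Y q)"

lemma crossing_transpose: "crossing Y X = crossing X Y"
  by (auto simp: crossing_def fun_eq_iff)

lemma crossing_rotate: "crossing (\<lambda>p. - X p) (\<lambda>p. - Y p) = crossing X Y"
  by (auto simp: crossing_def fun_eq_iff)

lemma separates_transpose: "separates Y X = separates X Y"
  by (auto simp: separates_def fun_eq_iff)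

lemma separates_rotate: "separates (\<lambda>p. - X p) (\<lambda>p. - Y p) S D \<Longrightarrow> separates X Y S (S - D)"
  unfolding separates_def by (simp add: double_diff psubset_imp_subset) blast

lemma finite_edges: "finite S \<Longrightarrow> finite (edges X Y S)"
  by (rule finite_subset[of _ "Pow S"]) (auto simp: edges_def)

lemma isolated_imp_separates:
  assumes "finite S" "inj_on X S" "inj_on Y S" "2 \<le> card S" "y \<in> S"
    and iso: "\<And>q. q \<in> S \<Longrightarrow> \<not> crossing X Y y q"
  shows "\<exists>D. separates X Y S D"
proof -
  have ne: "X q \<noteq> X y" "Y q \<noteq> Y y" if "q \<in> S" "q \<noteq> y" for q
    using that assms(2,3,5) by (auto dest: inj_onD)
  have before: "Y q < Y y" if "q \<in> S" "X q < X y" for q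
    using iso[OF that(1)] ne[OF that(1)] that by (auto simp: crossing_def not_less order_less_le)
  have after: "Y y < Y q" if "q \<in> S" "X y < X q" for q
    using iso[OF that(1)] ne[OF that(1)] that by (auto simp: crossing_def not_less order_less_le)
  define D where "D = {q \<in> S. X q < X y}"
  show ?thesis
  proof (cases "D = {}")
    case False
    have "X p < X q \<and> Y p < Y q" if "p \<in> D" "q \<in> S - D" for p q
      using before[of p] after[of q] ne[of q] that unfolding D_def
      by (cases "q = y") fastforce+
    then have "separates X Y S D" using False \<open>y \<in> S\<close> by (auto simp: separates_def D_def)
    then show ?thesis ..
  next
    case True
    have "X y < X q \<and> Y y < Y q" if "q \<in> S - {y}" for q
      using after[of q] ne[of q] that True unfolding D_def by fastforce
    moreover have "{y} \<noteq> S" using assms(4) by auto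
    ultimately have "separates X Y S {y}" using \<open>y \<in> S\<close> by (auto simp: separates_def)
    then show ?thesis ..
  qed
qed

text \<open>Every point outside \<open>T0\<close> owns two edges into \<open>T\<close>, one of them ending in \<open>T0\<close>.  The
  relation \<open>H\<close> of points to the hubs that serve them is asymmetric, so that no edge is owned by
  both of its ends.  The edges in \<open>F\<close> lie within \<open>T0\<close> and are owned by no point.\<close>

lemma charging:
  assumes "finite S" "T0 \<subseteq> T" "T0 \<subseteq> S"
    and own: "\<And>p. p \<in> S - T0 \<Longrightarrow>
      \<exists>f\<in>T0. \<exists>g\<in>T \<inter> S. f \<noteq> g \<and> crossing X Y p f \<and> crossing X Y p g \<and> (g \<in> T0 \<or> H p g)"
    and asym: "\<And>p q. H p q \<Longrightarrow> \<not> H q p"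
    and F: "F \<subseteq> edges X Y S" "\<And>e. e \<in> F \<Longrightarrow> e \<noteq> {} \<and> e \<subseteq> T0"
  shows "2 * card (S - T0) + card F \<le> card (meeting (edges X Y S) T)"
proof -
  have "\<forall>p\<in>S - T0. \<exists>fg. fst fg \<in> T0 \<and> snd fg \<in> T \<inter> S \<and> fst fg \<noteq> snd fg \<and>
      crossing X Y p (fst fg) \<and> crossing X Y p (snd fg) \<and> (snd fg \<in> T0 \<or> H p (snd fg))"
    using own by fastforce
  from bchoice[OF this] obtain h where h: "\<And>p. p \<in> S - T0 \<Longrightarrow> fst (h p) \<in> T0 \<and>
      snd (h p) \<in> T \<inter> S \<and> fst (h p) \<noteq> snd (h p) \<and> crossing X Y p (fst (h p)) \<and>
      crossing X Y p (snd (h p)) \<and> (snd (h p) \<in> T0 \<or> H p (snd (h p)))"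
    by blast
  define G where "G p = {{p, fst (h p)}, {p, snd (h p)}}" for p
  have card_G: "card (G p) = 2" if "p \<in> S - T0" for p
  proof -
    have "{p, fst (h p)} \<noteq> {p, snd (h p)}" using h[OF that] by (auto simp: doubleton_eq_iff)
    then show ?thesis by (simp add: G_def)
  qed
  have disj: "G p \<inter> G q = {}" if "p \<in> S - T0" "q \<in> S - T0" "p \<noteq> q" for p q
  proof (rule ccontr)
    assume "G p \<inter> G q \<noteq> {}"
    with h[OF that(1)] h[OF that(2)] that have "snd (h p) = q" "snd (h q) = p"
      by (auto simp: G_def doubleton_eq_iff)
    with h[OF that(1)] h[OF that(2)] that asym show False by auto
  qed
  have finF: "finite F" using F(1) finite_edges[OF assms(1)] by (rule finite_subset)
  have "2 * card (S - T0) = (\<Sum>p\<in>S - T0. card (G p))" using card_G by simp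
  also have "\<dots> = card (\<Union>p\<in>S - T0. G p)"
    using assms(1) disj by (intro card_UN_disjoint[symmetric]) (auto simp: G_def)
  finally have "2 * card (S - T0) + card F = card ((\<Union>p\<in>S - T0. G p) \<union> F)"
    using F(2) finF assms(1)
    by (subst card_Un_disjoint) (auto simp: G_def)
  also have "\<dots> \<le> card (meeting (edges X Y S) T)"
  proof (rule card_mono)
    show "finite (meeting (edges X Y S) T)"
      using finite_edges[OF assms(1)] by (simp add: meeting_def)
    have "{p, q} \<in> meeting (edges X Y S) T" if "p \<in> S" "q \<in> S" "crossing X Y p q" "q \<in> T" for p q
      using that by (auto simp: meeting_def edges_def)
    then have "G p \<subseteq> meeting (edges X Y S) T" if "p \<in> S - T0" for p
      using h[OF that] that assms(2,3) by (auto simp: G_def)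
    moreover have "F \<subseteq> meeting (edges X Y S) T"
      using F assms(2) by (fastforce simp: meeting_def)
    ultimately show "(\<Union>p\<in>S - T0. G p) \<union> F \<subseteq> meeting (edges X Y S) T" by blast
  qed
  finally show ?thesis .
qed

section \<open>Configurations that survive the deletion of an extreme point\<close>

text \<open>An indecomposable 1324-avoiding configuration with leftmost, rightmost, lowest and highest
  point \<open>l\<close>, \<open>r\<close>, \<open>d\<close>, \<open>u\<close>, which stays indecomposable if one of them is deleted.  These
  points need not be distinct.\<close>

locale robust_configuration =
  fixes S :: "'a set" and X Y :: "'a \<Rightarrow> int" and l r d u :: 'a
  assumes fin: "finite S" and card_S: "3 \<le> card S"
    and inj_X: "inj_on X S" and inj_Y: "inj_on Y S"
    and mem: "l \<in> S" "r \<in> S" "d \<in> S" "u \<in> S"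
    and left: "\<And>p. p \<in> S \<Longrightarrow> X l \<le> X p"
    and right: "\<And>p. p \<in> S \<Longrightarrow> X p \<le> X r"
    and down: "\<And>p. p \<in> S \<Longrightarrow> Y d \<le> Y p"
    and up: "\<And>p. p \<in> S \<Longrightarrow> Y p \<le> Y u"
    and avoids: "\<And>p q q' s. p \<in> S \<Longrightarrow> q \<in> S \<Longrightarrow> q' \<in> S \<Longrightarrow> s \<in> S \<Longrightarrow>
      X p < X q \<Longrightarrow> X q < X q' \<Longrightarrow> X q' < X s \<Longrightarrow>
      Y p < Y q' \<Longrightarrow> Y q' < Y q \<Longrightarrow> Y q < Y s \<Longrightarrow> False"
    and not_separated: "\<And>D. \<not> separates X Y S D"
    and not_separated_delete: "\<And>t D. t \<in> {l, r, d, u} \<Longrightarrow> \<not> separates X Y (S - {t}) D"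
begin

abbreviation cross :: "'a \<Rightarrow> 'a \<Rightarrow> bool" where "cross \<equiv> crossing X Y"

text \<open>Transposition (inverse permutation) and rotation (reverse complement) preserve the
  assumptions; transposition exchanges \<open>l\<close> with \<open>d\<close> and \<open>r\<close> with \<open>u\<close>, rotation exchanges \<open>l\<close>
  with \<open>r\<close> and \<open>d\<close> with \<open>u\<close>.\<close>

lemma transposed: "robust_configuration S Y X d u l r"
proof
  show False if "p \<in> S" "q \<in> S" "q' \<in> S" "s \<in> S" "Y p < Y q" "Y q < Y q'" "Y q' < Y s"
    "X p < X q'" "X q' < X q" "X q < X s" for p q q' s
    using avoids[of p q' q s] that by blast
  show "\<not> separates Y X (S - {t}) D" if "t \<in> {d, u, l, r}" for t D
    using not_separated_delete[of t] that unfolding separates_transpose[of Y X] by auto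
  show "\<not> separates Y X S D" for D
    using not_separated unfolding separates_transpose[of Y X] .
qed (use fin card_S inj_X inj_Y mem left right down up in simp_all)

lemma rotated: "robust_configuration S (\<lambda>p. - X p) (\<lambda>p. - Y p) r l u d"
proof
  show "inj_on (\<lambda>p. - X p) S" "inj_on (\<lambda>p. - Y p) S"
    using inj_X inj_Y by (auto simp: inj_on_def)
  show False if "p \<in> S" "q \<in> S" "q' \<in> S" "s \<in> S" "- X p < - X q" "- X q < - X q'"
    "- X q' < - X s" "- Y p < - Y q'" "- Y q' < - Y q" "- Y q < - Y s" for p q q' s
    using avoids[of s q' q p] that by simp
  show "\<not> separates (\<lambda>p. - X p) (\<lambda>p. - Y p) S D" for D
    using separates_rotate not_separated by blast
  show "\<not> separates (\<lambda>p. - X p) (\<lambda>p. - Y p) (S - {t}) D" if "t \<in> {r, l, u, d}" for t D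
    using separates_rotate not_separated_delete that by blast
qed (use fin card_S mem left right down up in simp_all)

lemma X_less: "p \<in> S \<Longrightarrow> q \<in> S \<Longrightarrow> p \<noteq> q \<Longrightarrow> \<not> X q < X p \<Longrightarrow> X p < X q"
  using inj_X by (auto dest: inj_onD simp: not_less order_less_le)

lemma Y_less: "p \<in> S \<Longrightarrow> q \<in> S \<Longrightarrow> p \<noteq> q \<Longrightarrow> \<not> Y q < Y p \<Longrightarrow> Y p < Y q"
  using inj_Y by (auto dest: inj_onD simp: not_less order_less_le)

lemma left_less: "p \<in> S \<Longrightarrow> p \<noteq> l \<Longrightarrow> X l < X p"
  using X_less[of l p] left[of p] mem by force
lemma right_less: "p \<in> S \<Longrightarrow> p \<noteq> r \<Longrightarrow> X p < X r"
  using X_less[of p r] right[of p] mem by force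
lemma down_less: "p \<in> S \<Longrightarrow> p \<noteq> d \<Longrightarrow> Y d < Y p"
  using Y_less[of d p] down[of p] mem by force
lemma up_less: "p \<in> S \<Longrightarrow> p \<noteq> u \<Longrightarrow> Y p < Y u"
  using Y_less[of p u] up[of p] mem by force

lemmas extreme_less = left_less right_less down_less up_less

lemma neighbour:
  assumes "p \<in> S"
  shows "\<exists>q\<in>S. cross p q"
  using isolated_imp_separates[OF fin inj_X inj_Y _ assms] card_S not_separated by force

lemma neighbour_delete:
  assumes "p \<in> S" "t \<in> {l, r, d, u}" "p \<noteq> t"
  shows "\<exists>q\<in>S. q \<noteq> t \<and> cross p q"
proof -
  have "2 \<le> card (S - {t})"
    using card_S assms(2) mem by (subst card_Diff_singleton) auto
  then show ?thesis
    using isolated_imp_separates[of "S - {t}" X Y p] fin inj_on_diff[OF inj_X] inj_on_diff[OF inj_Y]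
      assms not_separated_delete[OF assms(2)] by blast
qed

lemma l_neq_d: "l \<noteq> d"
  using neighbour[OF mem(1)] left down by (force simp: crossing_def)

lemma r_neq_u: "r \<noteq> u"
  using neighbour[OF mem(2)] right up by (force simp: crossing_def)

lemma l_neq_r: "l \<noteq> r"
  using neighbour[OF mem(1)] left right by (force simp: crossing_def)

lemma d_neq_u: "d \<noteq> u"
  using neighbour[OF mem(3)] down up by (force simp: crossing_def)

lemma cross_l: "p \<in> S \<Longrightarrow> Y p < Y l \<Longrightarrow> cross p l"
  using left_less[of p] by (cases "p = l") (auto simp: crossing_def)
lemma cross_r: "p \<in> S \<Longrightarrow> Y r < Y p \<Longrightarrow> cross p r"
  using right_less[of p] by (cases "p = r") (auto simp: crossing_def)
lemma cross_d: "p \<in> S \<Longrightarrow> X p < X d \<Longrightarrow> cross p d"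
  using down_less[of p] by (cases "p = d") (auto simp: crossing_def)
lemma cross_u: "p \<in> S \<Longrightarrow> X u < X p \<Longrightarrow> cross p u"
  using up_less[of p] by (cases "p = u") (auto simp: crossing_def)

lemma edge_ld: "{l, d} \<in> edges X Y S"
  using cross_d[OF mem(1) left_less[OF mem(3) l_neq_d[symmetric]]] mem
  by (auto simp: edges_def)
lemma edge_ur: "{u, r} \<in> edges X Y S"
  using cross_r[OF mem(4) up_less[OF mem(2) r_neq_u]] mem
  by (auto simp: edges_def)

section \<open>Hubs\<close>

text \<open>The points horizontally between \<open>d\<close> and \<open>u\<close> and below both \<open>l\<close> and \<open>r\<close> are joined to
  \<open>l\<close>, but to no other extreme point.  All their further neighbours are to the left of \<open>d\<close>, so
  such a neighbour of the highest of them is joined to all of them.  The set \<open>Z\<close> is empty or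
  consists of this neighbour.\<close>

lemma lower_middle_hub:
  "\<exists>Z\<subseteq>S - {l, r, d, u}. card Z \<le> 1 \<and> (\<forall>z\<in>Z. X z < X d) \<and>
     (\<forall>p\<in>S. X d < X p \<and> X p < X u \<and> Y p < Y l \<and> Y p < Y r \<longrightarrow> (\<exists>z\<in>Z. cross p z))"
proof -
  define L where "L = {p \<in> S. X d < X p \<and> X p < X u \<and> Y p < Y l \<and> Y p < Y r}"
  show ?thesis
  proof (cases "L = {}")
    case True
    then show ?thesis by (intro exI[of _ "{}"]) (auto simp: L_def)
  next
    case False
    have "finite L" using fin by (simp add: L_def)
    then have "Max (Y ` L) \<in> Y ` L" using False by (intro Max_in) auto
    then obtain y where y: "y \<in> L" "Y y = Max (Y ` L)" by (auto simp: image_iff)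
    have max: "Y p \<le> Y y" if "p \<in> L" for p using \<open>finite L\<close> that y(2) by auto
    from y have y': "y \<in> S" "X d < X y" "X y < X u" "Y y < Y l" "Y y < Y r"
      by (auto simp: L_def)
    have "y \<noteq> l" using y' by auto
    then obtain q where q: "q \<in> S" "q \<noteq> l" "cross y q"
      using neighbour_delete[OF y'(1), of l] by blast
    \<comment> \<open>Otherwise \<open>d\<close>, \<open>y\<close>, \<open>q\<close>, \<open>r\<close> form 1324.\<close>
    have q1: "X q < X y \<and> Y y < Y q"
    proof (rule ccontr)
      assume "\<not> ?thesis"
      with q(3) have "X y < X q" "Y q < Y y" by (auto simp: crossing_def)
      moreover have "q \<noteq> r" "q \<noteq> d" using calculation y' by auto
      ultimately show False
        using avoids[of d y q r] extreme_less[OF q(1)] y' q mem by auto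
    qed
    \<comment> \<open>Otherwise \<open>d\<close>, \<open>q\<close>, \<open>y\<close>, \<open>u\<close> form 1324.\<close>
    have "X q < X d"
    proof (rule ccontr)
      assume "\<not> X q < X d"
      moreover have "q \<noteq> d" "q \<noteq> u" "y \<noteq> d" using q1 y' down[OF y'(1)] by auto
      ultimately have "X d < X q" "Y d < Y y" "Y q < Y u"
        using X_less[OF mem(3) q(1)] down_less[OF y'(1)] up_less[OF q(1)] by auto
      then show False using avoids[of d q y u] y' q q1 mem by auto
    qed
    moreover have "q \<noteq> r" "q \<noteq> d" "q \<noteq> u" using q1 y' down[OF y'(1)] right[OF y'(1)] by auto
    moreover have "cross p q" if "p \<in> L" for p
      using max[OF that] that q1 \<open>X q < X d\<close> by (auto simp: L_def crossing_def)
    ultimately show ?thesis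
      using q by (intro exI[of _ "{q}"]) (auto simp: L_def)
  qed
qed

lemma upper_middle_hub:
  "\<exists>Z\<subseteq>S - {l, r, d, u}. card Z \<le> 1 \<and> (\<forall>z\<in>Z. X u < X z) \<and>
     (\<forall>p\<in>S. X d < X p \<and> X p < X u \<and> Y l < Y p \<and> Y r < Y p \<longrightarrow> (\<exists>z\<in>Z. cross p z))"
proof -
  interpret rot: robust_configuration S "\<lambda>p. - X p" "\<lambda>p. - Y p" r l u d by (rule rotated)
  have eq: "{r, l, u, d} = {l, r, d, u}" by auto
  show ?thesis
    using rot.lower_middle_hub unfolding eq crossing_rotate neg_less_iff_less by blast
qed

section \<open>Seven points that cover all but few edges\<close>

definition coverable :: bool where
  "coverable \<longleftrightarrow> (\<exists>T\<subseteq>S. card T \<le> 7 \<and> 2 * card S \<le> card (meeting (edges X Y S) T) + 6)"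

text \<open>The point \<open>p\<close> owns an edge to an extreme point and a second one to an extreme point or to
  a point of \<open>Z\<close> that serves \<open>p\<close> as a hub.\<close>

definition charged :: "'a set \<Rightarrow> ('a \<Rightarrow> 'a \<Rightarrow> bool) \<Rightarrow> 'a \<Rightarrow> bool" where
  "charged Z H p \<longleftrightarrow> (\<exists>f\<in>{l, r, d, u}. \<exists>g\<in>{l, r, d, u} \<union> Z. f \<noteq> g \<and> cross p f \<and>
     cross p g \<and> (g \<in> {l, r, d, u} \<or> H p g))"

lemma charged_by_extremes:
  assumes "f \<in> {l, r, d, u}" "g \<in> {l, r, d, u}" "f \<noteq> g" "cross p f" "cross p g"
  shows "charged Z H p"
  unfolding charged_def using assms
  by (intro bexI[of _ f] bexI[of _ g] conjI disjI1) auto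

lemma charged_by_hub:
  assumes "f \<in> {l, r, d, u}" "cross p f" "z \<in> Z" "z \<notin> {l, r, d, u}" "cross p z" "H p z"
  shows "charged Z H p"
  unfolding charged_def using assms
  by (intro bexI[of _ f] bexI[of _ z] conjI disjI2) auto

lemma charged_by_level_and_side:
  assumes "p \<in> S" "l \<noteq> u" "r \<noteq> d" "Y p < Y l \<or> Y r < Y p" "X p < X d \<or> X u < X p"
  shows "charged Z H p"
proof -
  have "cross p l \<or> cross p r" using cross_l cross_r assms by blast
  moreover have "cross p d \<or> cross p u" using cross_d cross_u assms by blast
  ultimately show ?thesis
    using l_neq_d r_neq_u assms(2,3) charged_by_extremes[of _ _ p] by auto
qed

lemma coverable_if_four_extremes:
  assumes "l \<noteq> u" "r \<noteq> d"
    and Z: "Z \<subseteq> S" "card Z \<le> 3" "finite Z"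
    and own: "\<And>p. p \<in> S - {l, r, d, u} \<Longrightarrow> charged Z H p"
    and asym: "\<And>p q. H p q \<Longrightarrow> \<not> H q p"
  shows coverable
proof -
  have c: "card {l, r, d, u} = 4"
    using assms(1,2) l_neq_d r_neq_u l_neq_r d_neq_u by auto
  have cF: "card {{l, d}, {u, r}} = 2"
    using assms(1,2) l_neq_d r_neq_u l_neq_r d_neq_u by (auto simp: doubleton_eq_iff)
  have "2 * card (S - {l, r, d, u}) + card {{l, d}, {u, r}}
      \<le> card (meeting (edges X Y S) ({l, r, d, u} \<union> Z))"
  proof (rule charging[OF fin _ _ _ asym])
    show "\<exists>f\<in>{l, r, d, u}. \<exists>g\<in>({l, r, d, u} \<union> Z) \<inter> S. f \<noteq> g \<and> cross p f \<and> cross p g \<and>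
        (g \<in> {l, r, d, u} \<or> H p g)" if "p \<in> S - {l, r, d, u}" for p
    proof -
      have "({l, r, d, u} \<union> Z) \<inter> S = {l, r, d, u} \<union> Z" using mem Z(1) by blast
      then show ?thesis using own[OF that] by (simp only: charged_def)
    qed
  qed (use mem edge_ld edge_ur in auto)
  moreover have "card (S - {l, r, d, u}) + 4 = card S"
    using c mem fin card_mono[of S "{l, r, d, u}"] by (subst card_Diff_subset) auto
  moreover have "card ({l, r, d, u} \<union> Z) \<le> 7"
    using card_Un_le[of "{l, r, d, u}" Z] c Z(2) by linarith
  ultimately show ?thesis
    unfolding coverable_def using mem Z(1) cF by (intro exI[of _ "{l, r, d, u} \<union> Z"]) auto
qed

lemma coverable_up_before_down:
  assumes "l \<noteq> u" "r \<noteq> d" "X u < X d" "Y r < Y l"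
  shows coverable
proof (rule coverable_if_four_extremes[OF assms(1,2), of "{}" "\<lambda>p q. False"])
  fix p assume p: "p \<in> S - {l, r, d, u}"
  have "X p < X d \<or> X u < X p" "Y p < Y l \<or> Y r < Y p" using assms by auto
  then show "charged {} (\<lambda>p q. False) p"
    using p assms(1,2) by (intro charged_by_level_and_side) auto
qed auto

lemma coverable_down_before_up:
  assumes "l \<noteq> u" "r \<noteq> d" "X d < X u" "Y r < Y l"
  shows coverable
proof -
  obtain Z where Z: "Z \<subseteq> S - {l, r, d, u}" "card Z \<le> 1" "\<forall>z\<in>Z. X z < X d"
    "\<forall>p\<in>S. X d < X p \<and> X p < X u \<and> Y p < Y l \<and> Y p < Y r \<longrightarrow> (\<exists>z\<in>Z. cross p z)"
    using lower_middle_hub by blast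
  obtain W where W: "W \<subseteq> S - {l, r, d, u}" "card W \<le> 1" "\<forall>z\<in>W. X u < X z"
    "\<forall>p\<in>S. X d < X p \<and> X p < X u \<and> Y l < Y p \<and> Y r < Y p \<longrightarrow> (\<exists>z\<in>W. cross p z)"
    using upper_middle_hub by blast
  \<comment> \<open>Only the points horizontally between \<open>d\<close> and \<open>u\<close> use hubs, and no hub is among these.\<close>
  define M where "M p \<longleftrightarrow> X d < X p \<and> X p < X u" for p
  show ?thesis
  proof (rule coverable_if_four_extremes[OF assms(1,2), of "Z \<union> W" "\<lambda>p q. M p \<and> \<not> M q"])
    show "Z \<union> W \<subseteq> S" using Z(1) W(1) by blast
    then show "finite (Z \<union> W)" using fin by (rule finite_subset)
    show "card (Z \<union> W) \<le> 3" using card_Un_le[of Z W] Z(2) W(2) by linarith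
    fix p assume p: "p \<in> S - {l, r, d, u}"
    then have pS: "p \<in> S" and ne: "p \<noteq> l" "p \<noteq> r" "p \<noteq> d" "p \<noteq> u" by auto
    have Y: "Y p < Y l \<or> Y r < Y p" using assms by auto
    show "charged (Z \<union> W) (\<lambda>p q. M p \<and> \<not> M q) p"
    proof (cases "M p")
      case False
      then have "X p < X d \<or> X u < X p"
        using X_less[OF mem(3) pS] X_less[OF pS mem(4)] ne by (auto simp: M_def)
      then show ?thesis using Y pS assms(1,2) by (intro charged_by_level_and_side)
    next
      case True
      have hub: "\<not> M g" "g \<notin> {l, r, d, u}" if "g \<in> Z \<union> W" for g
        using that Z(1,3) W(1,3) assms(3) by (auto simp: M_def)
      consider "Y p < Y l" "Y r < Y p" | "Y p < Y l" "Y p < Y r" | "Y l < Y p" "Y r < Y p"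
        using Y Y_less[OF pS mem(1)] Y_less[OF pS mem(2)] ne by fastforce
      then show ?thesis
      proof cases
        case 1
        then show ?thesis
          using l_neq_r cross_l[OF pS] cross_r[OF pS] by (intro charged_by_extremes[of l r]) auto
      next
        case 2
        then obtain z where "z \<in> Z" "cross p z" using Z(4) True pS unfolding M_def by blast
        then show ?thesis
          using hub[of z] True cross_l[OF pS 2(1)] by (intro charged_by_hub[of l _ z]) auto
      next
        case 3
        then obtain z where "z \<in> W" "cross p z" using W(4) True pS unfolding M_def by blast
        then show ?thesis
          using hub[of z] True cross_r[OF pS 3(2)] by (intro charged_by_hub[of r _ z]) auto
      qed
    qed
  qed blast
qed

text \<open>A point horizontally between \<open>d\<close> and \<open>u\<close> and vertically between \<open>l\<close> and \<open>r\<close> would be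
  isolated.\<close>

lemma centre_empty:
  assumes "p \<in> S" "X d < X p" "X p < X u" "Y l < Y p" "Y p < Y r"
  shows False
proof -
  obtain q where q: "q \<in> S" "cross p q" using neighbour[OF assms(1)] by blast
  show False
  proof (cases "X q < X p")
    case True
    with q have "Y p < Y q" by (auto simp: crossing_def)
    moreover have "q \<noteq> l" "q \<noteq> u" using calculation True assms by auto
    ultimately show False
      using avoids[of l q p u] extreme_less[OF q(1)] assms q mem True by auto
  next
    case False
    with q have "X p < X q" "Y q < Y p" by (auto simp: crossing_def)
    moreover have "q \<noteq> d" "q \<noteq> r" using calculation assms by auto
    ultimately show False
      using avoids[of d p q r] extreme_less[OF q(1)] assms q mem by auto
  qed
qed

text \<open>If no point is to the left of \<open>d\<close> and above \<open>r\<close>, the points that are not to the right of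
  \<open>d\<close> are below all points to the right of \<open>d\<close> and above \<open>l\<close>.  This is one half of the
  separation in \<open>corner_nonempty\<close>; the other half is its transpose.\<close>

lemma corner_order:
  assumes "Y l < Y r" and no_corner: "\<And>z. z \<in> S \<Longrightarrow> X z < X d \<Longrightarrow> Y r < Y z \<Longrightarrow> False"
    and "X d < X u" and pq: "p \<in> S" "q \<in> S" "X p \<le> X d" "X d < X q" "Y l < Y q"
  shows "X p < X q \<and> Y p < Y q"
proof -
  have X: "X p < X q" using pq by simp
  have "X d < X r" using right[OF mem(4)] assms(3) by simp
  have Yp: "Y p < Y r"
  proof (cases "p = d")
    case True
    then show ?thesis using down_less[OF mem(2)] \<open>X d < X r\<close> by auto
  next
    case False
    then have "X p < X d" using X_less[OF pq(1) mem(3)] pq by auto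
    moreover have "p \<noteq> r" using calculation \<open>X d < X r\<close> by auto
    ultimately show ?thesis using no_corner[OF pq(1)] Y_less[OF pq(1) mem(2)] by auto
  qed
  have "Y p < Y q"
  proof (rule ccontr)
    assume "\<not> Y p < Y q"
    then have "Y q < Y p" using Y_less[OF pq(2,1)] X by auto
    moreover have "p \<noteq> l" "q \<noteq> r" using calculation pq Yp by auto
    ultimately show False
      using avoids[of l p q r] extreme_less pq mem X Yp by auto
  qed
  with X show ?thesis by simp
qed

lemma corner_nonempty:
  assumes "X d < X u" "Y l < Y r"
  shows "\<exists>z\<in>S. (X z < X d \<and> Y r < Y z) \<or> (X u < X z \<and> Y z < Y l)"
proof (rule ccontr)
  assume n: "\<not> ?thesis"
  interpret tr: robust_configuration S Y X d u l r by (rule transposed)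
  define D where "D = {p \<in> S. X p \<le> X d \<or> Y p \<le> Y l}"
  have "X p < X q \<and> Y p < Y q" if "p \<in> D" "q \<in> S - D" for p q
  proof (cases "X p \<le> X d")
    case True
    show ?thesis
      by (rule corner_order) (use n assms that True in \<open>auto simp: D_def\<close>)
  next
    case False
    have "Y p < Y q \<and> X p < X q"
      by (rule tr.corner_order) (use n assms that False in \<open>auto simp: D_def\<close>)
    then show ?thesis by blast
  qed
  moreover have "d \<in> D" "u \<in> S - D"
    using mem assms up[of r] by (auto simp: D_def)
  ultimately have "separates X Y S D" by (auto simp: separates_def D_def)
  then show False using not_separated by blast
qed

text \<open>The corner point \<open>z\<close> is joined to all points horizontally between \<open>d\<close> and \<open>u\<close> and below
  \<open>l\<close>, and to all points right of \<open>u\<close> and vertically between \<open>l\<close> and \<open>r\<close>.  The other two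
  kinds of points with only one extreme neighbour have the hubs \<open>W\<close> and \<open>V\<close>.\<close>

lemma coverable_corner:
  assumes "X d < X u" "Y l < Y r" and z: "z \<in> S" "X z < X d" "Y r < Y z"
  shows coverable
proof -
  interpret tr: robust_configuration S Y X d u l r by (rule transposed)
  have ne: "l \<noteq> u" "r \<noteq> d"
    using up[of z] right[of u] assms mem by auto
  have eq: "{d, u, l, r} = {l, r, d, u}" by auto
  obtain W where W: "W \<subseteq> S - {l, r, d, u}" "card W \<le> 1" "\<forall>w\<in>W. Y w < Y l"
    "\<forall>p\<in>S. Y l < Y p \<and> Y p < Y r \<and> X p < X d \<and> X p < X u \<longrightarrow> (\<exists>w\<in>W. cross p w)"
    using tr.lower_middle_hub unfolding eq crossing_transpose[of Y X] by blast
  obtain V where V: "V \<subseteq> S - {l, r, d, u}" "card V \<le> 1" "\<forall>z\<in>V. X u < X z"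
    "\<forall>p\<in>S. X d < X p \<and> X p < X u \<and> Y l < Y p \<and> Y r < Y p \<longrightarrow> (\<exists>z\<in>V. cross p z)"
    using upper_middle_hub by blast
  define H where "H p q \<longleftrightarrow>
      ((X d < X p \<and> X p < X u \<and> Y p < Y l \<or> X u < X p \<and> Y l < Y p \<and> Y p < Y r) \<and> q = z) \<or>
      (X p < X d \<and> Y l < Y p \<and> Y p < Y r \<and> Y q < Y l) \<or>
      (X d < X p \<and> X p < X u \<and> Y r < Y p \<and> X u < X q)" for p q
  show ?thesis
  proof (rule coverable_if_four_extremes[OF ne, of "insert z (W \<union> V)" H])
    show sub: "insert z (W \<union> V) \<subseteq> S" using W(1) V(1) z by blast
    then show "finite (insert z (W \<union> V))" using fin by (rule finite_subset)
    show "card (insert z (W \<union> V)) \<le> 3"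
      using card_Un_le[of W V] W(2) V(2) card_insert_le_m1[of 3 "W \<union> V" z] by simp
    show "\<not> H q p" if "H p q" for p q
      using that assms unfolding H_def by auto
    fix p assume p: "p \<in> S - {l, r, d, u}"
    then have pS: "p \<in> S" and pe: "p \<noteq> l" "p \<noteq> r" "p \<noteq> d" "p \<noteq> u" by auto
    have zn: "z \<notin> {l, r, d, u}"
      using z assms right[of z] mem left[of d] right[of u] down[of z] by auto
    show "charged (insert z (W \<union> V)) H p"
    proof -
      consider (M) "X d < X p" "X p < X u" | (A) "X p < X d" "X p < X u" | (C) "X u < X p"
        using X_less[OF mem(3) pS] X_less[OF pS mem(4)] pe assms by fastforce
      then show ?thesis
      proof cases
        case M
        consider "Y p < Y l" | "Y r < Y p" "Y l < Y p"
          using centre_empty[OF pS M] Y_less[OF mem(1) pS] Y_less[OF pS mem(2)] pe assms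
          by fastforce
        then show ?thesis
        proof cases
          case 1
          have "cross p z" "H p z" using M 1 z assms by (auto simp: crossing_def H_def)
          then show ?thesis
            using cross_l[OF pS 1] zn by (intro charged_by_hub[of l _ z]) auto
        next
          case 2
          then obtain v where "v \<in> V" "cross p v" using V(4) M pS by blast
          moreover have "H p v" using V(3) \<open>v \<in> V\<close> M 2 by (auto simp: H_def)
          moreover have "v \<notin> {l, r, d, u}" using V(1) \<open>v \<in> V\<close> by blast
          ultimately show ?thesis
            using cross_r[OF pS 2(1)] by (intro charged_by_hub[of r _ v]) auto
        qed
      next
        case A
        consider "Y p < Y l" | "Y r < Y p" | "Y l < Y p" "Y p < Y r"
          using Y_less[OF mem(1) pS] Y_less[OF pS mem(2)] pe by fastforce
        then show ?thesis
        proof cases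
          case 3
          then obtain v where "v \<in> W" "cross p v" using W(4) A pS by blast
          moreover have "H p v" using W(3) \<open>v \<in> W\<close> A 3 by (auto simp: H_def)
          moreover have "v \<notin> {l, r, d, u}" using W(1) \<open>v \<in> W\<close> by blast
          ultimately show ?thesis
            using cross_d[OF pS A(1)] by (intro charged_by_hub[of d _ v]) auto
        qed (use A pS ne in \<open>intro charged_by_level_and_side; blast\<close>)+
      next
        case C
        consider "Y p < Y l" | "Y r < Y p" | "Y l < Y p" "Y p < Y r"
          using Y_less[OF mem(1) pS] Y_less[OF pS mem(2)] pe by fastforce
        then show ?thesis
        proof cases
          case 3
          have "cross p z" "H p z" using C 3 z assms by (auto simp: crossing_def H_def)
          then show ?thesis
            using cross_u[OF pS C] zn by (intro charged_by_hub[of u _ z]) auto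
        qed (use C pS ne in \<open>intro charged_by_level_and_side; blast\<close>)+
      qed
    qed
  qed
qed

text \<open>If the leftmost point is the highest, the points right of \<open>d\<close> and below \<open>r\<close> have \<open>l\<close> as
  their only extreme neighbour.  They form an increasing sequence and can be served by two hubs:
  one for those that have a further neighbour to the left of \<open>d\<close>, and one for the others, whose
  further neighbours are to the right of \<open>d\<close> and above \<open>r\<close>.\<close>

lemma lower_right_hubs:
  assumes lu: "l = u" and rd: "r \<noteq> d"
  shows "\<exists>Z\<subseteq>S - {l, r, d}. card Z \<le> 2 \<and> (\<forall>z\<in>Z. \<not> (X d < X z \<and> Y z < Y r)) \<and>
     (\<forall>p\<in>S. X d < X p \<and> Y p < Y r \<longrightarrow> (\<exists>z\<in>Z. cross p z))"
proof -
  define L where "L = {p \<in> S. X d < X p \<and> Y p < Y r}"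
  define A where "A = {q \<in> S - {l}. X q < X d}"
  define B where "B = {q \<in> S - {l}. X d < X q \<and> Y r < Y q}"
  have nb: "\<exists>q\<in>A \<union> B. X q < X y \<and> Y y < Y q" if y: "y \<in> L" for y
  proof -
    from y have y': "y \<in> S" "X d < X y" "Y y < Y r" by (auto simp: L_def)
    have "y \<noteq> l" using y' up[of r] mem lu by auto
    then obtain q where q: "q \<in> S" "q \<noteq> l" "cross y q"
      using neighbour_delete[OF y'(1), of l] by blast
    have q1: "X q < X y \<and> Y y < Y q"
    proof (rule ccontr)
      assume "\<not> ?thesis"
      with q(3) have "X y < X q" "Y q < Y y" by (auto simp: crossing_def)
      moreover have "q \<noteq> r" "q \<noteq> d" using calculation y' by auto
      ultimately show False
        using avoids[of d y q r] extreme_less[OF q(1)] y' q mem by auto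
    qed
    have "q \<noteq> r" "q \<noteq> d" "y \<noteq> r" "y \<noteq> d"
      using q1 y' down[OF y'(1)] right[OF y'(1)] by auto
    moreover have False if "X d < X q" "Y q < Y r"
      using avoids[of d q y r] that q1 y' q mem extreme_less[OF y'(1)] calculation by auto
    ultimately have "q \<in> A \<union> B"
      using X_less[of d q] Y_less[of q r] q mem by (auto simp: A_def B_def)
    with q1 show ?thesis by blast
  qed
  \<comment> \<open>A neighbour in \<open>A\<close> of the highest point of \<open>L1\<close> serves \<open>L1\<close>; a neighbour in \<open>B\<close> of the
    leftmost point of \<open>L2\<close> serves \<open>L2\<close>.\<close>
  define L1 where "L1 = {y \<in> L. \<exists>q\<in>A. Y y < Y q}"
  define L2 where "L2 = L - L1"
  have fl: "finite L1" "finite L2" using fin by (auto simp: L1_def L2_def L_def)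
  have sub: "A \<union> B \<subseteq> S - {l, r, d}"
    using right[of d] mem by (auto simp: A_def B_def)
  have "\<exists>Z\<subseteq>A. card Z \<le> 1 \<and> (\<forall>p\<in>L1. \<exists>z\<in>Z. cross p z)"
  proof (cases "L1 = {}")
    case False
    then have "Max (Y ` L1) \<in> Y ` L1" using fl by (intro Max_in) auto
    then obtain y where y: "y \<in> L1" "Y y = Max (Y ` L1)" by (auto simp: image_iff)
    then obtain q where q: "q \<in> A" "Y y < Y q" by (auto simp: L1_def)
    have "cross p q" if "p \<in> L1" for p
    proof -
      have "Y p \<le> Y y" using fl that y(2) by auto
      then show ?thesis using q that by (auto simp: L1_def L_def A_def crossing_def)
    qed
    then show ?thesis using q by (intro exI[of _ "{q}"]) auto
  qed (auto intro!: exI[of _ "{}"])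
  moreover have "\<exists>Z\<subseteq>B. card Z \<le> 1 \<and> (\<forall>p\<in>L2. \<exists>z\<in>Z. cross p z)"
  proof (cases "L2 = {}")
    case False
    then have "Min (X ` L2) \<in> X ` L2" using fl by (intro Min_in) auto
    then obtain y where y: "y \<in> L2" "X y = Min (X ` L2)" by (auto simp: image_iff)
    then obtain q where q: "q \<in> B" "X q < X y"
      using nb[of y] by (auto simp: L1_def L2_def)
    have "cross p q" if "p \<in> L2" for p
    proof -
      have "X y \<le> X p" using fl that y(2) by auto
      then show ?thesis using q that by (auto simp: L2_def L_def B_def crossing_def)
    qed
    then show ?thesis using q by (intro exI[of _ "{q}"]) auto
  qed (auto intro!: exI[of _ "{}"])
  ultimately obtain Z W where "Z \<subseteq> A" "W \<subseteq> B" "card Z \<le> 1" "card W \<le> 1"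
    "\<forall>p\<in>L1. \<exists>z\<in>Z. cross p z" "\<forall>p\<in>L2. \<exists>z\<in>W. cross p z" by blast
  then have "Z \<union> W \<subseteq> S - {l, r, d}" "card (Z \<union> W) \<le> 2"
    "\<forall>z\<in>Z \<union> W. \<not> (X d < X z \<and> Y z < Y r)" "\<forall>p\<in>L. \<exists>z\<in>Z \<union> W. cross p z"
    using sub card_Un_le[of Z W] by (fastforce simp: A_def B_def L2_def)+
  then show ?thesis by (intro exI[of _ "Z \<union> W"]) (simp add: L_def)
qed

text \<open>There are only three extreme points here, so two edges for each of the other \<open>n - 3\<close> points
  are enough.\<close>

lemma coverable_max_first:
  assumes lu: "l = u" and rd: "r \<noteq> d"
  shows coverable
proof -
  obtain Z where Z: "Z \<subseteq> S - {l, r, d}" "card Z \<le> 2"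
    "\<forall>z\<in>Z. \<not> (X d < X z \<and> Y z < Y r)"
    "\<forall>p\<in>S. X d < X p \<and> Y p < Y r \<longrightarrow> (\<exists>z\<in>Z. cross p z)"
    using lower_right_hubs[OF assms] by blast
  have c: "card {l, r, d} = 3" using rd l_neq_d l_neq_r by auto
  define L where "L p \<longleftrightarrow> X d < X p \<and> Y p < Y r" for p
  have "2 * card (S - {l, r, d}) + card ({} :: 'a set set)
      \<le> card (meeting (edges X Y S) ({l, r, d} \<union> Z))"
  proof (rule charging[OF fin, where H = "\<lambda>p q. L p \<and> \<not> L q"])
    fix p assume p: "p \<in> S - {l, r, d}"
    then have pS: "p \<in> S" and pe: "p \<noteq> l" "p \<noteq> r" "p \<noteq> d" by auto
    have pl: "cross p l" using cross_l[OF pS] up_less[OF pS] pe lu by auto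
    show "\<exists>f\<in>{l, r, d}. \<exists>g\<in>({l, r, d} \<union> Z) \<inter> S. f \<noteq> g \<and> cross p f \<and> cross p g \<and>
        (g \<in> {l, r, d} \<or> L p \<and> \<not> L g)"
    proof (cases "L p")
      case True
      then obtain z where "z \<in> Z" "cross p z" using Z(4) pS unfolding L_def by blast
      moreover have "z \<in> S" "z \<noteq> l" "\<not> L z" using calculation Z(1,3) by (auto simp: L_def)
      ultimately show ?thesis
        using True pl by (intro bexI[of _ l] bexI[of _ z] conjI disjI2) auto
    next
      case False
      then have "X p < X d \<or> Y r < Y p"
        using X_less[OF mem(3) pS] Y_less[OF pS mem(2)] pe by (auto simp: L_def)
      then have "\<exists>g\<in>{r, d}. cross p g" using cross_d[OF pS] cross_r[OF pS] by blast
      then show ?thesis using pl l_neq_d l_neq_r mem by auto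
    qed
  qed (use mem in auto)
  moreover have "card (S - {l, r, d}) + 3 = card S"
    using c mem fin card_mono[of S "{l, r, d}"] by (subst card_Diff_subset) auto
  moreover have "card ({l, r, d} \<union> Z) \<le> 7"
    using card_Un_le[of "{l, r, d}" Z] c Z(2) by linarith
  ultimately show ?thesis
    unfolding coverable_def using mem Z(1) by (intro exI[of _ "{l, r, d} \<union> Z"]) auto
qed

lemma coverable_max_first_min_last:
  assumes lu: "l = u" and rd: "r = d"
  shows coverable
proof -
  have c: "card {l, r} = 2" using l_neq_r by auto
  have "2 * card (S - {l, r}) + card ({} :: 'a set set) \<le> card (meeting (edges X Y S) {l, r})"
  proof (rule charging[OF fin, where H = "\<lambda>p q. False"])
    fix p assume p: "p \<in> S - {l, r}"
    then have "cross p l" "cross p r"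
      using cross_l[of p] cross_d[of p] extreme_less[of p] lu rd by auto
    then show "\<exists>f\<in>{l, r}. \<exists>g\<in>{l, r} \<inter> S. f \<noteq> g \<and> cross p f \<and> cross p g \<and>
        (g \<in> {l, r} \<or> False)"
      using l_neq_r mem by auto
  qed (use mem in auto)
  moreover have "card (S - {l, r}) + 2 = card S"
    using c mem fin card_mono[of S "{l, r}"] by (subst card_Diff_subset) auto
  ultimately show ?thesis
    unfolding coverable_def using mem c by (intro exI[of _ "{l, r}"]) auto
qed

theorem covering:
  "\<exists>T\<subseteq>S. card T \<le> 7 \<and> 2 * card S \<le> card (meeting (edges X Y S) T) + 6"
proof -
  interpret tr: robust_configuration S Y X d u l r by (rule transposed)
  interpret rot: robust_configuration S "\<lambda>p. - X p" "\<lambda>p. - Y p" r l u d by (rule rotated)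
  have tr: "tr.coverable \<longleftrightarrow> coverable"
    by (simp add: tr.coverable_def coverable_def edges_def crossing_transpose[of Y X])
  have rot: "rot.coverable \<longleftrightarrow> coverable"
    by (simp add: rot.coverable_def coverable_def edges_def crossing_rotate)
  have coverable
  proof (cases "l = u \<or> r = d")
    case True
    then show ?thesis
      using coverable_max_first coverable_max_first_min_last tr.coverable_max_first tr by blast
  next
    case False
    then have ne: "l \<noteq> u" "r \<noteq> d" by auto
    consider "X u < X d" "Y r < Y l" | "X d < X u" "Y r < Y l" | "X u < X d" "Y l < Y r"
      | "X d < X u" "Y l < Y r"
      using X_less[OF mem(3,4) d_neq_u] Y_less[OF mem(1,2) l_neq_r] by blast
    then show ?thesis
    proof cases
      case 1
      then show ?thesis using coverable_up_before_down ne by blast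
    next
      case 2
      then show ?thesis using coverable_down_before_up ne by blast
    next
      case 3
      then show ?thesis using tr.coverable_down_before_up ne tr by blast
    next
      case 4
      then obtain z where "z \<in> S" "X z < X d \<and> Y r < Y z \<or> X u < X z \<and> Y z < Y l"
        using corner_nonempty by blast
      then show ?thesis
        using coverable_corner[of z] rot.coverable_corner[of z] rot 4 by auto
    qed
  qed
  then show ?thesis by (simp add: coverable_def)
qed

end

section \<open>The configuration of a permutation\<close>

text \<open>The points are represented by the positions, the values being the ordinates.\<close>

definition inversion_edges :: "nat list \<Rightarrow> nat set set" where
  "inversion_edges p = edges int (\<lambda>i. int (p ! i)) {..<length p}"

lemma inj_on_inversions: "inj_on (\<lambda>(i, j). {i, j}) (inversions p)"
  by (auto simp: inj_on_def inversions_def doubleton_eq_iff)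

lemma image_inversions: "(\<lambda>(i, j). {i, j}) ` inversions p = inversion_edges p"
proof (intro equalityI subsetI)
  fix e assume "e \<in> (\<lambda>(i, j). {i, j}) ` inversions p"
  then show "e \<in> inversion_edges p"
    by (force simp: inversions_def inversion_edges_def edges_def crossing_def)
next
  fix e assume "e \<in> inversion_edges p"
  then obtain i j where "e = {i, j}" "(i, j) \<in> inversions p \<or> (j, i) \<in> inversions p"
    by (auto simp: inversions_def inversion_edges_def edges_def crossing_def)
  then show "e \<in> (\<lambda>(i, j). {i, j}) ` inversions p"
    by (auto simp: insert_commute intro: rev_image_eqI)
qed

lemma inv_count_eq_card_edges: "inv_count p = card (inversion_edges p)"
  unfolding inv_count_def image_inversions[symmetric]
  by (rule card_image[OF inj_on_inversions, symmetric])

lemma inv_count_outside_eq_card_edges: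
  assumes "distinct p" "T \<subseteq> {..<length p}"
  shows "inv_count_outside p ((!) p ` T) =
    card (inversion_edges p - meeting (inversion_edges p) T)"
proof -
  let ?I = "{(i, j) \<in> inversions p. p ! i \<notin> (!) p ` T \<and> p ! j \<notin> (!) p ` T}"
  have mem: "p ! i \<in> (!) p ` T \<longleftrightarrow> i \<in> T" if "i < length p" for i
    using assms that by (auto simp: nth_eq_iff_index_eq subset_iff)
  have "p ! i \<notin> (!) p ` T \<and> p ! j \<notin> (!) p ` T \<longleftrightarrow> i \<notin> T \<and> j \<notin> T"
    if "(i, j) \<in> inversions p" for i j
    using that mem[of i] mem[of j] by (auto simp: inversions_def)
  then have I: "?I = {(i, j) \<in> inversions p. i \<notin> T \<and> j \<notin> T}" by blast
  have "inj_on (\<lambda>(i, j). {i, j}) ?I"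
    by (rule inj_on_subset[OF inj_on_inversions]) auto
  then have "card ?I = card ((\<lambda>(i, j). {i, j}) ` ?I)" by (simp add: card_image)
  also have "(\<lambda>(i, j). {i, j}) ` ?I = inversion_edges p - meeting (inversion_edges p) T"
    unfolding I image_inversions[symmetric] by (force simp: meeting_def)
  finally show ?thesis by (simp add: inv_count_outside_def)
qed

lemma decomposable_if_prefix_below:
  assumes q: "permutation q" and j: "1 \<le> j" "j < length q"
    and below: "\<And>i k. i < j \<Longrightarrow> j \<le> k \<Longrightarrow> k < length q \<Longrightarrow> q ! i < q ! k"
  shows "decomposable q"
proof -
  have d: "distinct q" "set q = {1..length q}" using q by (auto simp: permutation_def)
  have c: "card (set (take j q)) = j" using d(1) j by (simp add: distinct_card)
  have "x \<in> {1..j}" if x: "x \<in> set (take j q)" for x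
  proof -
    have xq: "x \<in> {1..length q}" using x d(2) by (metis in_set_takeD)
    obtain i where i: "i < j" "x = q ! i" using x j by (auto simp: in_set_conv_nth)
    have "{1..x} \<subseteq> set (take j q)"
    proof
      fix y assume y: "y \<in> {1..x}"
      then have "y \<in> set q" using d(2) xq by auto
      then obtain k where k: "k < length q" "y = q ! k" by (auto simp: in_set_conv_nth)
      have "k < j"
      proof (rule ccontr)
        assume "\<not> k < j"
        with below[of i k] i k y show False by simp
      qed
      then show "y \<in> set (take j q)" using k by (auto simp: in_set_conv_nth)
    qed
    from card_mono[OF _ this] have "x \<le> j" using c by simp
    with xq show ?thesis by simp
  qed
  then have "set (take j q) = {1..j}" using c by (intro card_subset_eq) auto
  with j show ?thesis by (auto simp: decomposable_def)
qed

text \<open>The list \<open>js\<close> contains the positions of \<open>p\<close> that are kept; it is either the list of all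
  positions or lacks one of them.\<close>

lemma separated_positions_split_list:
  assumes srt: "sorted_wrt (<) js" and D: "separates int (\<lambda>i. int (p ! i)) (set js) D"
  shows "\<exists>j. 1 \<le> j \<and> j < length js \<and>
    (\<forall>i k. i < j \<longrightarrow> j \<le> k \<longrightarrow> k < length js \<longrightarrow> map ((!) p) js ! i < map ((!) p) js ! k)"
proof -
  from D have ne: "D \<noteq> {}" "D \<subset> set js"
    and lt: "\<And>a b. a \<in> D \<Longrightarrow> b \<in> set js \<Longrightarrow> b \<notin> D \<Longrightarrow> a < b \<and> p ! a < p ! b"
    by (auto simp: separates_def)
  define j where "j = length (takeWhile (\<lambda>a. a \<in> D) js)"
  have in_D: "js ! i \<in> D" if "i < j" for i
    using that takeWhile_nth[of i "\<lambda>a. a \<in> D" js] set_takeWhileD[of "js ! i" "\<lambda>a. a \<in> D" js]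
      nth_mem[of i "takeWhile (\<lambda>a. a \<in> D) js"] by (simp add: j_def)
  have notin_D: "js ! k \<notin> D" if "j \<le> k" "k < length js" for k
  proof
    assume k: "js ! k \<in> D"
    have "js ! j \<notin> D" using nth_length_takeWhile[of "\<lambda>a. a \<in> D" js] that by (simp add: j_def)
    then have "j < k" "js ! k < js ! j" using k lt[OF k, of "js ! j"] that
      by (auto simp: order_less_le)
    with sorted_wrt_nth_less[OF srt, of j k] that show False by simp
  qed
  obtain a where "a \<in> D" using ne by blast
  then obtain k where "k < length js" "js ! k \<in> D"
    using ne by (metis in_set_conv_nth psubset_imp_subset subsetD)
  then have "1 \<le> j" using notin_D[of k] by (cases j) auto
  moreover have "j < length js"
  proof (rule ccontr)
    assume "\<not> j < length js"
    then have "set js \<subseteq> D" using in_D by (auto simp: in_set_conv_nth)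
    with ne show False by auto
  qed
  ultimately show ?thesis
    using in_D notin_D lt by (intro exI[of _ j]) auto
qed

lemma indecomposable_imp_not_separated:
  assumes "permutation p" "\<not> decomposable p"
  shows "\<not> separates int (\<lambda>i. int (p ! i)) {..<length p} D"
proof
  assume "separates int (\<lambda>i. int (p ! i)) {..<length p} D"
  then have "separates int (\<lambda>i. int (p ! i)) (set [0..<length p]) D"
    by (simp add: atLeast0LessThan)
  from separated_positions_split_list[OF _ this]
  obtain j where "1 \<le> j" "j < length p"
    "\<And>i k. i < j \<Longrightarrow> j \<le> k \<Longrightarrow> k < length p \<Longrightarrow> p ! i < p ! k"
    by (auto simp: map_nth)
  with decomposable_if_prefix_below assms show False by blast
qed

lemma indecomposable_delete_imp_not_separated:
  assumes "permutation p" "i < length p" "\<not> decomposable (delete_entry p (p ! i))"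
  shows "\<not> separates int (\<lambda>i. int (p ! i)) ({..<length p} - {i}) D"
proof
  assume D: "separates int (\<lambda>i. int (p ! i)) ({..<length p} - {i}) D"
  have d: "distinct p" using assms(1) by (simp add: permutation_def)
  define js where "js = filter (\<lambda>k. k \<noteq> i) [0..<length p]"
  have "set js = {..<length p} - {i}" by (auto simp: js_def)
  with D have D': "separates int (\<lambda>i. int (p ! i)) (set js) D" by simp
  have "sorted_wrt (<) js" unfolding js_def by (intro sorted_wrt_filter) simp
  from separated_positions_split_list[OF this D'] obtain j where
    j: "1 \<le> j" "j < length js" and
    lt: "\<And>a k. a < j \<Longrightarrow> j \<le> k \<Longrightarrow> k < length js \<Longrightarrow> map ((!) p) js ! a < map ((!) p) js ! k"
    by blast
  have "removeAll (p ! i) p = filter (\<lambda>x. x \<noteq> p ! i) (map ((!) p) [0..<length p])"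
    by (simp only: removeAll_filter_not_eq map_nth) (metis (mono_tags))
  also have "\<dots> = map ((!) p) js"
    unfolding filter_map js_def comp_def
    by (intro arg_cong[of _ _ "map ((!) p)"] filter_cong refl)
      (use d assms(2) in \<open>auto simp: nth_eq_iff_index_eq\<close>)
  finally have r: "removeAll (p ! i) p = map ((!) p) js" .
  have dist: "distinct (map ((!) p) js)"
    using d unfolding r[symmetric] by (simp add: distinct_removeAll)
  have len: "length (standardize (map ((!) p) js)) = length js" by (simp add: standardize_def)
  have "decomposable (standardize (map ((!) p) js))"
  proof (rule decomposable_if_prefix_below[OF permutation_standardize[OF dist] j(1)])
    show "j < length (standardize (map ((!) p) js))" using j(2) len by simp
    show "standardize (map ((!) p) js) ! a < standardize (map ((!) p) js) ! k"
      if "a < j" "j \<le> k" "k < length (standardize (map ((!) p) js))" for a k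
      using standardize_less_iff[of a "map ((!) p) js" k] lt[of a k] that j len by simp
  qed
  then show False using assms(3) r by (simp add: delete_entry_def)
qed

text \<open>From length 3 on, the position 0 and the position \<open>n - 1\<close> are the leftmost and the rightmost
  point; \<open>d\<close> and \<open>u\<close> are the positions of 1 and \<open>n\<close>.\<close>

lemma residual_configuration:
  assumes p: "p \<in> residuals \<delta> n" and n: "3 \<le> n"
  shows "\<exists>d u. robust_configuration {..<n} int (\<lambda>i. int (p ! i)) 0 (n - 1) d u"
proof -
  from p have perm: "permutation p" and len: "length p = n" and av: "avoids_1324 p"
    and ind: "\<not> decomposable p" and alm: "\<not> almost_decomposable p"
    by (auto simp: residuals_def Av1324_def)
  have dist: "distinct p" and set: "set p = {1..n}" using perm len by (auto simp: permutation_def)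
  have range: "1 \<le> p ! i \<and> p ! i \<le> n" if "i < n" for i
    using nth_mem[of i p] that set len by auto
  have "1 \<in> set p" "n \<in> set p" using set n by auto
  then obtain d u where d: "d < n" "p ! d = 1" and u: "u < n" "p ! u = n"
    using len by (auto simp: in_set_conv_nth)
  have ne: "p \<noteq> []" using n len by auto
  have hl: "hd p = p ! 0" "last p = p ! (n - 1)"
    using hd_conv_nth[OF ne] last_conv_nth[OF ne] len by simp_all
  have del: "\<not> decomposable (delete_entry p (p ! t))" if "t \<in> {0, n - 1, d, u}" for t
    using that alm ind d u hl len by (auto simp: almost_decomposable_def)
  have "robust_configuration {..<n} int (\<lambda>i. int (p ! i)) 0 (n - 1) d u"
  proof
    show "inj_on (\<lambda>i. int (p ! i)) {..<n}"
      using dist len by (auto simp: inj_on_def nth_eq_iff_index_eq)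
    show False if "a \<in> {..<n}" "b \<in> {..<n}" "c \<in> {..<n}" "e \<in> {..<n}"
      "int a < int b" "int b < int c" "int c < int e" "int (p ! a) < int (p ! c)"
      "int (p ! c) < int (p ! b)" "int (p ! b) < int (p ! e)" for a b c e
    proof -
      have "a < b \<and> b < c \<and> c < e \<and> e < length p \<and> p ! a < p ! c \<and> p ! c < p ! b \<and> p ! b < p ! e"
        using that len by simp
      then show False using av unfolding avoids_1324_def by blast
    qed
    show "\<not> separates int (\<lambda>i. int (p ! i)) {..<n} D" for D
      using indecomposable_imp_not_separated[OF perm ind] len by simp
    show "\<not> separates int (\<lambda>i. int (p ! i)) ({..<n} - {t}) D" if "t \<in> {0, n - 1, d, u}" for t D
    proof -
      have "t < length p" using that n d u len by auto
      from indecomposable_delete_imp_not_separated[OF perm this del[OF that]] show ?thesis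
        using len by simp
    qed
  qed (use n d u range in auto)
  then show ?thesis by blast
qed

text \<open>The bound \<open>\<delta> + 7\<close> rather than 7 is used only for short permutations, for which \<open>T\<close> can
  contain all positions.\<close>

lemma residual_covering:
  assumes p: "p \<in> residuals \<delta> n" and "1 \<le> \<delta>"
  shows "\<exists>T\<subseteq>{..<n}. card T \<le> \<delta> + 7 \<and> inv_count_outside p ((!) p ` T) \<le> \<delta> - 1"
proof (cases "n \<le> \<delta> + 7")
  case True
  have "length p = n" using p by (simp add: residuals_def Av1324_def)
  then have "{(i, j) \<in> inversions p. p ! i \<notin> (!) p ` {..<n} \<and> p ! j \<notin> (!) p ` {..<n}} = {}"
    by (auto simp: inversions_def)
  then have "inv_count_outside p ((!) p ` {..<n}) = 0"
    by (simp only: inv_count_outside_def card.empty)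
  with True show ?thesis by (intro exI[of _ "{..<n}"]) simp
next
  case False
  from p have len: "length p = n" and dist: "distinct p"
    and inv: "int (inv_count p) = 2 * int n - 7 + int \<delta>"
    by (auto simp: residuals_def Av1324_def permutation_def)
  obtain d u where "robust_configuration {..<n} int (\<lambda>i. int (p ! i)) 0 (n - 1) d u"
    using residual_configuration[OF p] False by auto
  then interpret robust_configuration "{..<n}" int "\<lambda>i. int (p ! i)" 0 "n - 1" d u .
  obtain T where T: "T \<subseteq> {..<n}" "card T \<le> 7"
    "2 * n \<le> card (meeting (inversion_edges p) T) + 6"
    using covering len by (auto simp: inversion_edges_def)
  have "finite (inversion_edges p)" unfolding inversion_edges_def by (rule finite_edges) simp
  then have "card (inversion_edges p - meeting (inversion_edges p) T) =
      inv_count p - card (meeting (inversion_edges p) T)"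
    unfolding inv_count_eq_card_edges
    by (intro card_Diff_subset) (auto simp: meeting_def intro: finite_subset)
  then have "inv_count_outside p ((!) p ` T) =
      inv_count p - card (meeting (inversion_edges p) T)"
    using inv_count_outside_eq_card_edges[OF dist] T(1) len by simp
  then have "inv_count_outside p ((!) p ` T) \<le> \<delta> - 1" using T(3) inv assms(2) by linarith
  with T show ?thesis by (intro exI[of _ T]) auto
qed


section \<open>The length of the skeleton\<close>

text \<open>The positions at which a maximal run of consecutive increasing values ends; the last
  position is one of them.\<close>

definition breaks :: "nat list \<Rightarrow> nat set" where
  "breaks xs = {i. i < length xs \<and> (Suc i < length xs \<longrightarrow> xs ! Suc i \<noteq> xs ! i + 1)}"

lemma finite_breaks [simp]: "finite (breaks xs)"
  by (rule finite_subset[of _ "{..<length xs}"]) (auto simp: breaks_def)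

lemma card_breaks_append:
  assumes "us \<noteq> []" "ws \<noteq> [] \<Longrightarrow> hd ws \<noteq> last us + 1"
  shows "card (breaks ws) + 1 \<le> card (breaks (us @ ws))"
proof -
  let ?m = "length us"
  have "insert (?m - 1) ((+) ?m ` breaks ws) \<subseteq> breaks (us @ ws)"
  proof
    fix i assume "i \<in> insert (?m - 1) ((+) ?m ` breaks ws)"
    then consider "i = ?m - 1" | k where "i = ?m + k" "k \<in> breaks ws" by auto
    then show "i \<in> breaks (us @ ws)"
    proof cases
      case 1
      have "i < ?m" "Suc i = ?m" using 1 assms(1) by (cases us; simp)+
      moreover have "last us = us ! i" using 1 assms(1) by (simp add: last_conv_nth)
      ultimately show ?thesis
        using assms(2) by (auto simp: breaks_def nth_append hd_conv_nth)
    next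
      case 2
      then show ?thesis by (auto simp: breaks_def nth_append)
    qed
  qed
  moreover have "?m - 1 \<notin> (+) ?m ` breaks ws" using assms(1) by (cases us) auto
  then have "card (insert (?m - 1) ((+) ?m ` breaks ws)) = card (breaks ws) + 1"
    by (simp add: card_image)
  ultimately show ?thesis by (metis card_mono finite_breaks)
qed

lemma length_runs_le_card_breaks:
  "maximal_runs ps \<Longrightarrow> length ps \<le> card (breaks (runs_concat ps))"
proof (induction ps)
  case (Cons q ps)
  obtain a k where q: "q = (a, k)" by (cases q)
  have k: "1 \<le> k" and m: "maximal_runs ps"
    using Cons.prems q by (auto simp: maximal_runs_def successively_Cons)
  have "card (breaks (runs_concat ps)) + 1
      \<le> card (breaks ([a + 1 ..< a + k + 1] @ runs_concat ps))"
  proof (rule card_breaks_append)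
    show "[a + 1 ..< a + k + 1] \<noteq> []" using k by simp
    assume "runs_concat ps \<noteq> []"
    then obtain c j ps' where ps: "ps = (c, j) # ps'" by (cases ps) auto
    with Cons.prems q have "1 \<le> j" "c \<noteq> a + k" by (auto simp: maximal_runs_def)
    moreover have "hd (runs_concat ps) = c + 1"
      using ps upt_head[OF calculation(1), of c] by simp
    moreover have "last [a + 1 ..< a + k + 1] = a + k" using k by simp
    ultimately show "hd (runs_concat ps) \<noteq> last [a + 1 ..< a + k + 1] + 1" by simp
  qed
  with Cons.IH[OF m] q show ?case by simp
qed simp

lemma length_skeleton_le_card_breaks:
  assumes "permutation p"
  shows "length (skeleton p) \<le> card (breaks p)"
proof -
  obtain s b where r: "reduced_inflation p s b" using reduced_inflation_exists[OF assms] by blast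
  then have p: "runs_concat (inflation_runs s b) = p"
    unfolding reduced_inflation_def inflate_eq_runs_concat by blast
  have len: "length (inflation_runs s b) = length s" by (simp add: inflation_runs_def)
  show ?thesis
    using length_runs_le_card_breaks[OF maximal_inflation_runs[OF r]]
    unfolding len p skeleton_eq[OF r] .
qed

text \<open>The set \<open>V\<close> in the proof contains the ends of the inversions outside \<open>T\<close>.  For a break \<open>i\<close>
  with \<open>i\<close> and \<open>i + 1\<close> outside \<open>T \<union> V\<close>, the position \<open>k\<close> of the value \<open>p ! i + 1\<close> lies in
  \<open>T\<close>, since otherwise \<open>k\<close> would form an inversion with \<open>i\<close> or \<open>i + 1\<close>.  The function \<open>f\<close>
  recovers \<open>i\<close> from \<open>k\<close>.\<close>

lemma card_breaks_le:
  assumes p: "permutation p" and T: "T \<subseteq> {..<length p}"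
  shows "card (breaks p) \<le> 1 + 3 * card T + 4 * inv_count_outside p ((!) p ` T)"
proof -
  let ?n = "length p"
  define I where "I = {(i, j) \<in> inversions p. p ! i \<notin> (!) p ` T \<and> p ! j \<notin> (!) p ` T}"
  define V where "V = fst ` I \<union> snd ` I"
  define f where "f k = (THE i. i < ?n \<and> p ! i + 1 = p ! k)" for k
  have dist: "distinct p" and set: "set p = {1..?n}" using p by (auto simp: permutation_def)
  have finI: "finite I"
    by (rule finite_subset[of _ "{..<?n} \<times> {..<?n}"]) (auto simp: I_def inversions_def)
  have finT: "finite T" using T finite_subset by blast
  have mem: "p ! i \<in> (!) p ` T \<longleftrightarrow> i \<in> T" if "i < ?n" for i
    using dist T that by (auto simp: nth_eq_iff_index_eq subset_iff)
  have iso: "i \<in> V \<and> j \<in> V" if "i < j" "j < ?n" "p ! j < p ! i" "i \<notin> T" "j \<notin> T" for i j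
  proof -
    have "(i, j) \<in> I" using that mem by (auto simp: I_def inversions_def)
    then show ?thesis unfolding V_def by force
  qed
  define W where "W = T \<union> V"
  have "i \<in> insert (?n - 1) (W \<union> (\<lambda>k. k - 1) ` W \<union> f ` T)" if i: "i \<in> breaks p" for i
  proof (rule ccontr)
    assume no: "\<not> ?thesis"
    have i1: "i < ?n" using i by (simp add: breaks_def)
    have i2: "Suc i < ?n" using i1 no by auto
    have br: "p ! Suc i \<noteq> p ! i + 1" using i i2 by (simp add: breaks_def)
    have iW: "i \<notin> T" "i \<notin> V" using no by (auto simp: W_def)
    have sW: "Suc i \<notin> T" "Suc i \<notin> V" using no by (force simp: W_def)+
    have "p ! i \<noteq> p ! Suc i" using dist i1 i2 by (simp add: nth_eq_iff_index_eq)
    then have lt: "p ! i + 1 < p ! Suc i" using iso[of i "Suc i"] iW sW i2 br by fastforce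
    have "p ! Suc i \<in> {1..?n}" using set i2 nth_mem by blast
    then have "p ! i + 1 \<in> set p" using set lt by auto
    then obtain k where k: "k < ?n" "p ! k = p ! i + 1" by (auto simp: in_set_conv_nth)
    have "k \<in> T"
    proof (rule ccontr)
      assume kT: "k \<notin> T"
      have "k \<noteq> i" "k \<noteq> Suc i" using k lt by auto
      then consider "k < i" | "Suc i < k" by linarith
      then show False
        using iso[of k i] iso[of "Suc i" k] k kT i1 iW sW lt by cases auto
    qed
    moreover have "f k = i" unfolding f_def
      using k i1 dist by (intro the_equality) (auto simp: nth_eq_iff_index_eq)
    ultimately show False using no by auto
  qed
  then have sub: "breaks p \<subseteq> insert (?n - 1) (W \<union> (\<lambda>k. k - 1) ` W \<union> f ` T)" by blast
  have finW: "finite W" using finI finT by (simp add: W_def V_def)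
  have cV: "card V \<le> 2 * card I"
    using card_Un_le[of "fst ` I" "snd ` I"] card_image_le[OF finI, of fst]
      card_image_le[OF finI, of snd] unfolding V_def by linarith
  have cW: "card W \<le> card T + 2 * card I" using cV card_Un_le[of T V] by (simp add: W_def)
  have "card (breaks p) \<le> card (insert (?n - 1) (W \<union> (\<lambda>k. k - 1) ` W \<union> f ` T))"
    using sub finW finT by (intro card_mono) auto
  also have "\<dots> \<le> Suc (card (W \<union> (\<lambda>k. k - 1) ` W \<union> f ` T))"
    by (simp add: card_insert_le_m1 card_insert_if finW finT)
  also have "\<dots> \<le> Suc (card W + card W + card T)"
    using card_Un_le[of "W \<union> (\<lambda>k. k - 1) ` W" "f ` T"] card_Un_le[of W "(\<lambda>k. k - 1) ` W"]
      card_image_le[OF finW, of "\<lambda>k. k - 1"] card_image_le[OF finT, of f] by linarith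
  also have "\<dots> \<le> 1 + 3 * card T + 4 * card I" using cW by linarith
  finally show ?thesis by (simp add: inv_count_outside_def I_def)
qed

lemma length_skeleton_le:
  assumes p: "p \<in> residuals \<delta> n" and "1 \<le> \<delta>"
  shows "length (skeleton p) \<le> 8 * \<delta> + 25"
proof -
  have perm: "permutation p" and len: "length p = n"
    using p by (auto simp: residuals_def Av1324_def)
  obtain T where T: "T \<subseteq> {..<n}" "card T \<le> \<delta> + 7"
    "inv_count_outside p ((!) p ` T) \<le> \<delta> - 1"
    using residual_covering[OF assms] by blast
  have "card (breaks p) \<le> 1 + 3 * card T + 4 * inv_count_outside p ((!) p ` T)"
    using card_breaks_le[OF perm] T(1) len by simp
  then show ?thesis using T(2,3) length_skeleton_le_card_breaks[OF perm] assms(2) by linarith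
qed

lemma reduced_skeleton:
  assumes "permutation p"
  shows "permutation (skeleton p) \<and> reduced (skeleton p)"
proof -
  obtain s b where r: "reduced_inflation p s b" using reduced_inflation_exists[OF assms] by blast
  then show ?thesis using skeleton_eq[OF r] by (simp add: reduced_inflation_def)
qed

lemma finite_permutations_of_length_le: "finite {s. permutation s \<and> length s \<le> N}"
proof (rule finite_subset)
  show "{s. permutation s \<and> length s \<le> N} \<subseteq> {s. set s \<subseteq> {1..N} \<and> length s \<le> N}"
    by (auto simp: permutation_def)
qed (simp add: finite_lists_length_le)

theorem theorem5p23:
  fixes \<delta> :: nat
  assumes "\<delta> \<ge> 1"
  shows "(\<forall>n. \<forall>p \<in> residuals \<delta> n.
            \<exists>T \<subseteq> set p. card T \<le> \<delta> + 7 \<and> inv_count_outside p T \<le> \<delta> - 1)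
       \<and> (\<forall>n. \<forall>p \<in> residuals \<delta> n. length (skeleton p) \<le> 8 * \<delta> + 25)
       \<and> (\<forall>s \<in> skeletons \<delta>. permutation s \<and> reduced s \<and> length s \<le> 8 * \<delta> + 25)
       \<and> finite (skeletons \<delta>)"
proof (intro conjI allI ballI)
  fix n p assume p: "p \<in> residuals \<delta> n"
  then have len: "length p = n" by (simp add: residuals_def Av1324_def)
  obtain T where T: "T \<subseteq> {..<n}" "card T \<le> \<delta> + 7"
    "inv_count_outside p ((!) p ` T) \<le> \<delta> - 1"
    using residual_covering[OF p assms] by blast
  have "card ((!) p ` T) \<le> \<delta> + 7"
    using T(1,2) card_image_le[of T "(!) p"] finite_subset[OF T(1)] by simp
  moreover have "(!) p ` T \<subseteq> set p" using T(1) len by auto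
  ultimately show "\<exists>T \<subseteq> set p. card T \<le> \<delta> + 7 \<and> inv_count_outside p T \<le> \<delta> - 1"
    using T(3) by blast
  show "length (skeleton p) \<le> 8 * \<delta> + 25" by (rule length_skeleton_le[OF p assms])
next
  have sk: "permutation s \<and> reduced s \<and> length s \<le> 8 * \<delta> + 25" if s: "s \<in> skeletons \<delta>" for s
  proof -
    obtain n p where p: "p \<in> residuals \<delta> n" "s = skeleton p"
      using s by (auto simp: skeletons_def)
    then have "permutation p" by (simp add: residuals_def Av1324_def)
    with p reduced_skeleton length_skeleton_le[OF p(1) assms] show ?thesis by blast
  qed
  then show "permutation s" "reduced s" "length s \<le> 8 * \<delta> + 25" if "s \<in> skeletons \<delta>" for s
    using that by blast+
  show "finite (skeletons \<delta>)"
    using sk by (intro finite_subset[OF _ finite_permutations_of_length_le]) blast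
qed

end
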